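(* Suppose that the chain $\Phi$ with (stochastic or sub-stochastic) transition kernel $P$ on $(X,\mathcal{B}(X))$ is $\psi$-irreducible. Then the following statements are equivalent. (1) There exist a set $A\in\mathcal{B}^{+}(X)$ and $\kappa>1$ such that $$\sup_{x\in A}\sum_{n=1}^{\infty}\kappa^{n}P^{n}(x,A)<\infty.$$ (2) There exist a set $A\in\mathcal{B}^{+}(X)$ and $\kappa>1$ such that $$\sup_{x\in A}\mathbb{E}_x\left[\kappa^{\tau_A}1_{\{\tau_A<\infty\}}\right]<1.$$ (3) There exist a set $A\in\mathcal{B}^{+}(X)$ and $\kappa>1$ such that $$\sup_{x\in A}L(x,A)<1,\qquad \sup_{x\in A}\mathbb{E}_x\left[\kappa^{\tau_A}1_{\{\tau_A<\infty\}}\right]<\infty.$$ (4) There exist a set $A\in\mathcal{B}^{+}(X)$, constants $b,\lambda\in(0,1)$, and a measurable function $W:X\to[0,\infty]$ with $W\geq 1_A$ and $W(x_0)<\infty$ for some $x_0\in X$, satisfying $$PW(x)\leq\lambda W(x)1_{A^{c}}(x)+b\,1_A(x),\qquad x\in X.$$ (5) The chain $\Phi$ is geometrically transient.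
   Context: Setting: $\Phi=\{\Phi_n:n\in\mathbb{Z}_+\}$ is a discrete-time homogeneous Markov chain on a general state space $X$ with a countably generated $\sigma$-field $\mathcal{B}(X)$. $P^n(x,A)=\mathbb{P}_x\{\Phi_n\in A\}$ is its $n$-step transition kernel; $P$ may be stochastic or sub-stochastic (in the sub-stochastic case the chain may leave $X$, after which it never returns). $\mathbb{P}_x,\mathbb{E}_x$ refer to $\Phi_0=x$. For measurable $f\ge 0$, $P^nf(x)=\int_X f(y)P^n(x,dy)$. Irreducibility: $\Phi$ is $\psi$-irreducible, where $\psi$ is a maximal irreducibility measure: $\psi$ is a nontrivial $\sigma$-finite measure such that $\psi(A)>0$ implies that for every $x\in X$ there is $n\ge1$ with $P^n(x,A)>0$, and every other measure with this property is absolutely continuous with respect to $\psi$. $\mathcal{B}^{+}(X)=\{A\in\mathcal{B}(X):\psi(A)>0\}$. First return time: $\tau_A=\inf\{n\geq1:\Phi_n\in A\}$ ($\inf\emptyset=\infty$), and $L(x,A)=\mathbb{P}_x\{\tau_A<\infty\}$. Geometric transience: a set $A\in\mathcal{B}^{+}(X)$ is called uniformly geometric transient if there is a constant $\kappa>1$ with $\sup_{x\in A}\sum_{n=1}^{\infty}\kappa^{n}P^{n}(x,A)<\infty$. The chain $\Phi$ is geometrically transient if it is $\psi$-irreducible and there exist sets $D$ and $A_i$, $i=1,2,\dots$ with $X=D\cup\bigcup_{i=1}^{\infty}A_i$, $\psi(D)=0$, and each $A_i$ uniformly geometric transient (the constant $\kappa$ may depend on $i$). *)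

theory Defs
  imports "HOL-Probability.Probability"
begin

text \<open>A measurable space \<open>(X, B(X))\<close> is represented by a measure \<open>X\<close> of which only \<open>space X\<close> and
  \<open>sets X\<close> are used. A stochastic or sub-stochastic transition kernel on it is a
  \<open>P \<in> X \<rightarrow>\<^sub>M subprob_algebra X\<close>.\<close>

definition countably_generated :: "'a measure \<Rightarrow> bool" where
  "countably_generated X \<longleftrightarrow>
     (\<exists>G. countable G \<and> G \<subseteq> Pow (space X) \<and> sets X = sigma_sets (space X) G)"

primrec kernel_pow :: "'a measure \<Rightarrow> ('a \<Rightarrow> 'a measure) \<Rightarrow> nat \<Rightarrow> 'a \<Rightarrow> 'a measure" where
  "kernel_pow X P 0 x = return X x"
| "kernel_pow X P (Suc n) x = kernel_pow X P n x \<bind> P"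


section \<open>The chain and its path law\<close>

text \<open>A sub-stochastic chain may leave \<open>X\<close> for good. Its trajectories live in the space enlarged by
  the cemetery \<open>None\<close>, an absorbing state which receives the missing mass \<open>1 - P x (space X)\<close>.\<close>

definition cemetery_space :: "'a measure \<Rightarrow> 'a option measure" where
  "cemetery_space X = sigma (insert None (Some ` space X))
     {B. B \<subseteq> insert None (Some ` space X) \<and> Some -` B \<in> sets X}"

definition cemetery_kernel ::
  "'a measure \<Rightarrow> ('a \<Rightarrow> 'a measure) \<Rightarrow> 'a option \<Rightarrow> 'a option measure" where
  "cemetery_kernel X P s = measure_of (space (cemetery_space X)) (sets (cemetery_space X))
     (\<lambda>B. case s of None \<Rightarrow> indicator B None
        | Some x \<Rightarrow> emeasure (P x) (Some -` B) + (1 - emeasure (P x) (space X)) * indicator B None)"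

definition path_step ::
  "'a measure \<Rightarrow> ('a \<Rightarrow> 'a measure) \<Rightarrow> 'a \<Rightarrow> nat \<Rightarrow> (nat \<Rightarrow> 'a option) \<Rightarrow> 'a option measure" where
  "path_step X P x i \<omega> =
     (case i of 0 \<Rightarrow> return (cemetery_space X) (Some x) | Suc n \<Rightarrow> cemetery_kernel X P (\<omega> n))"

text \<open>The law \<open>\<P>\<^sub>x\<close> of the chain started at \<open>x\<close>: the measure on trajectories which the
  Ionescu-Tulcea theorem yields for the above steps. The chain \<open>\<Phi>\<close> is the coordinate process
  \<open>\<Phi>\<^sub>n \<omega> = \<omega> n\<close>, and \<open>\<Phi>\<^sub>n \<in> A\<close> reads \<open>\<omega> n \<in> Some ` A\<close>.\<close>

definition path_law ::
  "'a measure \<Rightarrow> ('a \<Rightarrow> 'a measure) \<Rightarrow> 'a \<Rightarrow> (nat \<Rightarrow> 'a option) measure" where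
  "path_law X P x = projective_family.lim UNIV
     (Ionescu_Tulcea.CI (path_step X P x) (\<lambda>_. cemetery_space X)) (\<lambda>_. cemetery_space X)"

definition return_time :: "'a set \<Rightarrow> (nat \<Rightarrow> 'a option) \<Rightarrow> enat" where
  "return_time A \<omega> = Inf {enat n | n. 1 \<le> n \<and> \<omega> n \<in> Some ` A}"

definition return_prob :: "'a measure \<Rightarrow> ('a \<Rightarrow> 'a measure) \<Rightarrow> 'a \<Rightarrow> 'a set \<Rightarrow> ennreal" where
  "return_prob X P x A =
     emeasure (path_law X P x) {\<omega> \<in> space (path_law X P x). return_time A \<omega> < \<infinity>}"

text \<open>\<open>\<E>\<^sub>x[\<kappa>^\<tau>\<^sub>A 1{\<tau>\<^sub>A < \<infinity>}]\<close>\<close>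

definition return_moment ::
  "'a measure \<Rightarrow> ('a \<Rightarrow> 'a measure) \<Rightarrow> real \<Rightarrow> 'a \<Rightarrow> 'a set \<Rightarrow> ennreal" where
  "return_moment X P \<kappa> x A =
     (\<integral>\<^sup>+\<omega>. ennreal (\<kappa> ^ the_enat (return_time A \<omega>)) * indicator {\<omega>. return_time A \<omega> < \<infinity>} \<omega>
        \<partial>path_law X P x)"


section \<open>Irreducibility and geometric transience\<close>

definition irreducibility_measure ::
  "'a measure \<Rightarrow> ('a \<Rightarrow> 'a measure) \<Rightarrow> 'a measure \<Rightarrow> bool" where
  "irreducibility_measure X P \<phi> \<longleftrightarrow> sets \<phi> = sets X \<and>
     (\<forall>A\<in>sets X. emeasure \<phi> A > 0 \<longrightarrow>
        (\<forall>x\<in>space X. \<exists>n\<ge>1. emeasure (kernel_pow X P n x) A > 0))"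

text \<open>\<open>\<psi>\<close>-irreducibility, with \<open>\<psi>\<close> a maximal irreducibility measure. The library's
  \<open>absolutely_continuous \<psi> \<phi>\<close> says that \<open>\<phi>\<close> is absolutely continuous with respect to \<open>\<psi>\<close>.\<close>

definition psi_irreducible ::
  "'a measure \<Rightarrow> ('a \<Rightarrow> 'a measure) \<Rightarrow> 'a measure \<Rightarrow> bool" where
  "psi_irreducible X P \<psi> \<longleftrightarrow>
     sigma_finite_measure \<psi> \<and> emeasure \<psi> (space X) > 0 \<and> irreducibility_measure X P \<psi> \<and>
     (\<forall>\<phi>. irreducibility_measure X P \<phi> \<longrightarrow> absolutely_continuous \<psi> \<phi>)"

definition pos_sets :: "'a measure \<Rightarrow> 'a measure \<Rightarrow> 'a set set" where
  "pos_sets X \<psi> = {A \<in> sets X. emeasure \<psi> A > 0}"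

text \<open>The sum over \<open>n \<ge> 1\<close> is written with \<open>Suc n\<close> for \<open>n\<close>.\<close>

definition uniformly_geometric_transient ::
  "'a measure \<Rightarrow> ('a \<Rightarrow> 'a measure) \<Rightarrow> 'a measure \<Rightarrow> 'a set \<Rightarrow> bool" where
  "uniformly_geometric_transient X P \<psi> A \<longleftrightarrow> A \<in> pos_sets X \<psi> \<and>
     (\<exists>\<kappa>::real. \<kappa> > 1 \<and>
        (SUP x\<in>A. \<Sum>n. ennreal (\<kappa> ^ Suc n) * emeasure (kernel_pow X P (Suc n) x) A) < \<infinity>)"

definition geometrically_transient ::
  "'a measure \<Rightarrow> ('a \<Rightarrow> 'a measure) \<Rightarrow> 'a measure \<Rightarrow> bool" where
  "geometrically_transient X P \<psi> \<longleftrightarrow> psi_irreducible X P \<psi> \<and>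
     (\<exists>D (A :: nat \<Rightarrow> 'a set). D \<in> sets X \<and> emeasure \<psi> D = 0 \<and>
        (\<forall>i\<ge>1. uniformly_geometric_transient X P \<psi> (A i)) \<and>
        space X = D \<union> (\<Union>i\<in>{1..}. A i))"


section \<open>The path law is that of a Markov chain with kernel \<open>P\<close>\<close>

lemma
  shows space_cemetery_space: "space (cemetery_space X) = insert None (Some ` space X)"
    and sets_cemetery_space: "sets (cemetery_space X) =
      {B. B \<subseteq> insert None (Some ` space X) \<and> Some -` B \<in> sets X}"
proof -
  let ?\<Omega> = "insert None (Some ` space X)"
  let ?S = "{B. B \<subseteq> ?\<Omega> \<and> Some -` B \<in> sets X}"
  have "sigma_algebra ?\<Omega> ?S"
    unfolding sigma_algebra_iff2
  proof (intro conjI ballI allI impI)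
    show "{} \<in> ?S" by simp
  next
    fix B assume B: "B \<in> ?S"
    have "Some -` (?\<Omega> - B) = space X - Some -` B"
      by blast
    with B show "?\<Omega> - B \<in> ?S"
      by (metis (no_types, lifting) Diff_subset mem_Collect_eq sets.compl_sets)
  next
    fix B :: "nat \<Rightarrow> 'a option set" assume "range B \<subseteq> ?S"
    then have "\<And>i. B i \<subseteq> ?\<Omega>" "\<And>i. Some -` B i \<in> sets X"
      by blast+
    then show "(\<Union>i. B i) \<in> ?S"
      unfolding mem_Collect_eq vimage_UN by blast
  qed blast
  then interpret sigma_algebra ?\<Omega> ?S .
  show "space (cemetery_space X) = ?\<Omega>" "sets (cemetery_space X) = ?S"
    unfolding cemetery_space_def
    using space_measure_of[OF space_closed] sets_measure_of_eq by simp_all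
qed

lemma measurable_Some_cemetery [measurable]: "Some \<in> X \<rightarrow>\<^sub>M cemetery_space X"
proof (rule measurableI)
  fix B assume "B \<in> sets (cemetery_space X)"
  then have "Some -` B \<in> sets X" by (simp add: sets_cemetery_space)
  then show "Some -` B \<inter> space X \<in> sets X" by (rule sets.Int) simp
qed (simp add: space_cemetery_space)

lemma Some_image_in_sets_cemetery: "A \<in> sets X \<Longrightarrow> Some ` A \<in> sets (cemetery_space X)"
  using sets.sets_into_space[of A X]
  by (simp add: sets_cemetery_space inj_vimage_image_eq image_mono subset_insertI2)

lemma
  shows space_cemetery_kernel: "space (cemetery_kernel X P s) = space (cemetery_space X)"
    and sets_cemetery_kernel [measurable_cong]:
      "sets (cemetery_kernel X P s) = sets (cemetery_space X)"
  unfolding cemetery_kernel_def by (simp_all add: space_measure_of sets.space_closed)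

lemma emeasure_cemetery_kernel_None:
  assumes "B \<in> sets (cemetery_space X)"
  shows "emeasure (cemetery_kernel X P None) B = indicator B None"
proof -
  have "countably_additive (sets (cemetery_kernel X P None))
      (\<lambda>B. case None of None \<Rightarrow> indicator B None
       | Some x \<Rightarrow> emeasure (P x) (Some -` B) + (1 - emeasure (P x) (space X)) * indicator B None)"
    by (auto simp: countably_additive_def suminf_indicator)
  then show ?thesis
    using emeasure_measure_of[OF cemetery_kernel_def, of X P None B] assms
    by (simp add: positive_def sets_cemetery_kernel sets.space_closed)
qed

lemma emeasure_cemetery_kernel_Some:
  assumes P: "P \<in> X \<rightarrow>\<^sub>M subprob_algebra X" and x: "x \<in> space X"
    and B: "B \<in> sets (cemetery_space X)"
  shows "emeasure (cemetery_kernel X P (Some x)) B =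
    emeasure (P x) (Some -` B) + (1 - emeasure (P x) (space X)) * indicator B None"
proof -
  have sets_P: "sets (P x) = sets X"
    using P x by (rule subprob_measurableD)
  let ?\<mu> = "\<lambda>B. case Some x of None \<Rightarrow> indicator B None
     | Some x \<Rightarrow> emeasure (P x) (Some -` B) + (1 - emeasure (P x) (space X)) * indicator B None"
  have "countably_additive (sets (cemetery_kernel X P (Some x))) ?\<mu>"
    unfolding countably_additive_def
  proof (intro allI impI)
    fix B :: "nat \<Rightarrow> 'a option set"
    assume B: "range B \<subseteq> sets (cemetery_kernel X P (Some x))" and disj: "disjoint_family B"
    have "range (\<lambda>i. Some -` B i) \<subseteq> sets (P x)"
      using B by (auto simp: sets_P sets_cemetery_kernel sets_cemetery_space)
    moreover have "disjoint_family (\<lambda>i. Some -` B i)"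
      using disj by (auto simp: disjoint_family_on_def)
    ultimately have "(\<Sum>i. emeasure (P x) (Some -` B i)) = emeasure (P x) (\<Union>i. Some -` B i)"
      by (rule suminf_emeasure)
    then show "(\<Sum>i. ?\<mu> (B i)) = ?\<mu> (\<Union>i. B i)"
      by (simp add: suminf_add[symmetric] suminf_indicator[OF disj] vimage_UN)
  qed
  then show ?thesis
    using emeasure_measure_of[OF cemetery_kernel_def, of X P "Some x" B] B
    by (simp add: positive_def sets_cemetery_kernel sets.space_closed)
qed

lemma prob_space_cemetery_kernel:
  assumes P: "P \<in> X \<rightarrow>\<^sub>M subprob_algebra X" and s: "s \<in> space (cemetery_space X)"
  shows "prob_space (cemetery_kernel X P s)"
proof (rule prob_spaceI)
  have *: "Some -` insert None (Some ` space X) = space X"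
    by blast
  show "emeasure (cemetery_kernel X P s) (space (cemetery_kernel X P s)) = 1"
  proof (cases s)
    case None
    then show ?thesis
      by (simp add: space_cemetery_kernel emeasure_cemetery_kernel_None) (simp add: space_cemetery_space)
  next
    case (Some x)
    with s have x: "x \<in> space X"
      by (auto simp: space_cemetery_space)
    interpret subprob_space "P x"
      using P x by (rule subprob_space_kernel)
    have le: "emeasure (P x) (space X) \<le> 1"
      by (rule subprob_emeasure_le_1)
    have "emeasure (cemetery_kernel X P s) (space (cemetery_kernel X P s)) =
        emeasure (P x) (space X) + (1 - emeasure (P x) (space X))"
      unfolding Some space_cemetery_kernel
      by (subst emeasure_cemetery_kernel_Some[OF P x sets.top]) (simp add: space_cemetery_space *)
    also have "\<dots> = 1"
      using le by (simp add: ennreal_ineq_diff_add)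
    finally show ?thesis .
  qed
qed

lemma measurable_cemetery_space_cases:
  assumes "(\<lambda>x. f (Some x)) \<in> X \<rightarrow>\<^sub>M N" and "f None \<in> space N"
  shows "f \<in> cemetery_space X \<rightarrow>\<^sub>M N"
proof (rule measurableI)
  fix s assume "s \<in> space (cemetery_space X)"
  then show "f s \<in> space N"
    using assms measurable_space[OF assms(1)] by (auto simp: space_cemetery_space)
next
  fix B assume "B \<in> sets N"
  then have B: "(\<lambda>x. f (Some x)) -` B \<inter> space X \<in> sets X"
    by (rule measurable_sets[OF assms(1)])
  have *: "Some -` (f -` B \<inter> space (cemetery_space X)) = (\<lambda>x. f (Some x)) -` B \<inter> space X"
    by (auto simp: space_cemetery_space)
  show "f -` B \<inter> space (cemetery_space X) \<in> sets (cemetery_space X)"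
    unfolding sets_cemetery_space mem_Collect_eq * space_cemetery_space[symmetric] using B by simp
qed

lemma measurable_cemetery_kernel:
  assumes P[measurable]: "P \<in> X \<rightarrow>\<^sub>M subprob_algebra X"
  shows "cemetery_kernel X P \<in> cemetery_space X \<rightarrow>\<^sub>M subprob_algebra (cemetery_space X)"
proof (rule measurable_cemetery_space_cases)
  show "cemetery_kernel X P None \<in> space (subprob_algebra (cemetery_space X))"
    by (auto simp: space_subprob_algebra sets_cemetery_kernel space_cemetery_space
        intro!: prob_space_imp_subprob_space prob_space_cemetery_kernel[OF P])
  show "(\<lambda>x. cemetery_kernel X P (Some x)) \<in> X \<rightarrow>\<^sub>M subprob_algebra (cemetery_space X)"
  proof (rule measurable_subprob_algebra)
    fix x assume "x \<in> space X"
    then show "subprob_space (cemetery_kernel X P (Some x))"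
      by (intro prob_space_imp_subprob_space prob_space_cemetery_kernel[OF P])
        (simp add: space_cemetery_space)
  next
    fix B assume B: "B \<in> sets (cemetery_space X)"
    then have [measurable]: "Some -` B \<in> sets X"
      by (simp add: sets_cemetery_space)
    have "(\<lambda>x. emeasure (P x) (Some -` B) + (1 - emeasure (P x) (space X)) * indicator B None)
        \<in> borel_measurable X"
      by measurable
    then show "(\<lambda>x. emeasure (cemetery_kernel X P (Some x)) B) \<in> borel_measurable X"
      by (rule measurable_cong[THEN iffD2, rotated])
        (simp add: emeasure_cemetery_kernel_Some[OF P _ B])
  qed (simp add: sets_cemetery_kernel)
qed

lemma nn_integral_cemetery_kernel_None:
  assumes f: "f \<in> borel_measurable (cemetery_space X)"
  shows "(\<integral>\<^sup>+s. f s \<partial>cemetery_kernel X P None) = f None"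
proof -
  have "cemetery_kernel X P None = return (cemetery_space X) None"
    by (rule measure_eqI)
      (simp_all add: sets_cemetery_kernel emeasure_cemetery_kernel_None)
  then show ?thesis
    using f by (simp add: nn_integral_return space_cemetery_space)
qed

lemma nn_integral_cemetery_kernel_Some:
  assumes P: "P \<in> X \<rightarrow>\<^sub>M subprob_algebra X" and x: "x \<in> space X"
    and f: "f \<in> borel_measurable (cemetery_space X)"
  shows "(\<integral>\<^sup>+s. f s \<partial>cemetery_kernel X P (Some x)) =
    (\<integral>\<^sup>+y. f (Some y) \<partial>P x) + (1 - emeasure (P x) (space X)) * f None"
proof -
  have sets_P[measurable_cong]: "sets (P x) = sets X"
    using P x by (rule subprob_measurableD)
  have sp: "space (P x) = space X"
    by (rule sets_eq_imp_space_eq[OF sets_P])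
  have S: "Some \<in> P x \<rightarrow>\<^sub>M cemetery_space X"
    using measurable_Some_cemetery by (simp cong: measurable_cong_sets add: sets_P)
  let ?D = "distr (P x) (cemetery_space X) Some"
  let ?c = "1 - emeasure (P x) (space X)"
  let ?K = "cemetery_kernel X P (Some x)"
  have "f \<in> borel_measurable ?K"
    using f by (simp cong: measurable_cong_sets add: sets_cemetery_kernel)
  then show ?thesis
  proof (induction rule: borel_measurable_induct)
    case (cong f g)
    then have "f (Some y) = g (Some y)" if "y \<in> space X" for y
      using that by (simp add: space_cemetery_kernel space_cemetery_space)
    moreover have "f None = g None"
      using cong by (simp add: space_cemetery_kernel space_cemetery_space)
    ultimately show ?case
      using cong nn_integral_cong[of ?K f g] nn_integral_cong[of "P x" "\<lambda>y. f (Some y)" "\<lambda>y. g (Some y)"]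
      by (simp add: sp)
  next
    case (set B)
    have B: "B \<in> sets (cemetery_space X)"
      using set by (simp add: sets_cemetery_kernel)
    then have "Some -` B \<in> sets (P x)"
      by (simp add: sets_P sets_cemetery_space)
    moreover have "(\<lambda>y. indicator B (Some y) :: ennreal) = indicator (Some -` B)"
      by (auto simp: indicator_def)
    ultimately show ?case
      using set by (simp add: emeasure_cemetery_kernel_Some[OF P x B])
  next
    case (mult u c)
    have "u \<in> borel_measurable (cemetery_space X)"
      using mult by (simp cong: measurable_cong_sets add: sets_cemetery_kernel)
    from measurable_compose[OF S this] show ?case
      using mult by (simp add: nn_integral_cmult distrib_left mult_ac)
  next
    case (add u v)
    have "u \<in> borel_measurable (cemetery_space X)" "v \<in> borel_measurable (cemetery_space X)"
      using add by (simp_all cong: measurable_cong_sets add: sets_cemetery_kernel)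
    from this[THEN measurable_compose[OF S]] show ?case
      using add by (simp add: nn_integral_add distrib_left add_ac)
  next
    case (seq U)
    have "U i \<in> borel_measurable (cemetery_space X)" for i
      using seq by (simp cong: measurable_cong_sets add: sets_cemetery_kernel)
    note U = this[THEN measurable_compose[OF S]]
    have inc: "incseq (\<lambda>i y. U i (Some y))" "incseq (\<lambda>i. U i None)"
      using \<open>incseq U\<close> by (auto simp: incseq_def le_fun_def)
    have "(\<integral>\<^sup>+s. (SUP i. U i s) \<partial>?K) = (SUP i. \<integral>\<^sup>+s. U i s \<partial>?K)"
      using seq by (intro nn_integral_monotone_convergence_SUP) auto
    also have "\<dots> = (SUP i. (\<integral>\<^sup>+y. U i (Some y) \<partial>P x) + ?c * U i None)"
      using seq by simp
    also have "\<dots> = (SUP i. \<integral>\<^sup>+y. U i (Some y) \<partial>P x) + (SUP i. ?c * U i None)"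
      using inc by (intro ennreal_SUP_add)
        (auto simp: incseq_def le_fun_def intro!: nn_integral_mono mult_left_mono)
    also have "\<dots> = (\<integral>\<^sup>+y. (SUP i. U i (Some y)) \<partial>P x) + ?c * (SUP i. U i None)"
      using inc U by (simp add: nn_integral_monotone_convergence_SUP SUP_mult_left_ennreal)
    finally show ?case by (simp add: SUP_apply image_comp)
  qed
qed

lemma Ionescu_Tulcea_path_step:
  assumes P: "P \<in> X \<rightarrow>\<^sub>M subprob_algebra X" and x: "x \<in> space X"
  shows "Ionescu_Tulcea (path_step X P x) (\<lambda>_. cemetery_space X)"
proof -
  have Sx: "Some x \<in> space (cemetery_space X)"
    using x by (simp add: space_cemetery_space)
  show ?thesis
  proof (rule Ionescu_Tulcea.intro)
    fix i
    show "path_step X P x i \<in>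
        Pi\<^sub>M {0..<i} (\<lambda>_. cemetery_space X) \<rightarrow>\<^sub>M subprob_algebra (cemetery_space X)"
    proof (cases i)
      case 0
      then show ?thesis
        using measurable_const[OF measurable_space[OF return_measurable Sx]]
        by (simp add: path_step_def[abs_def])
    next
      case (Suc n)
      have "(\<lambda>\<omega>. \<omega> n) \<in> Pi\<^sub>M {0..<i} (\<lambda>_. cemetery_space X) \<rightarrow>\<^sub>M cemetery_space X"
        using Suc by (intro measurable_component_singleton) simp
      from measurable_compose[OF this measurable_cemetery_kernel[OF P]] show ?thesis
        by (simp add: path_step_def[abs_def] Suc)
    qed
  next
    fix i and \<omega> :: "nat \<Rightarrow> 'a option"
    assume \<omega>: "\<omega> \<in> space (Pi\<^sub>M {0..<i} (\<lambda>_. cemetery_space X))"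
    show "prob_space (path_step X P x i \<omega>)"
    proof (cases i)
      case 0
      then show ?thesis using Sx by (simp add: path_step_def prob_space_return)
    next
      case (Suc n)
      then have "\<omega> n \<in> space (cemetery_space X)"
        using \<omega> by (auto simp: space_PiM)
      then show ?thesis
        using prob_space_cemetery_kernel[OF P] by (simp add: path_step_def Suc)
    qed
  qed
qed

lemma
  assumes "P \<in> X \<rightarrow>\<^sub>M subprob_algebra X" and "x \<in> space X"
  shows sets_path_law: "sets (path_law X P x) = sets (Pi\<^sub>M UNIV (\<lambda>_. cemetery_space X))"
    and prob_space_path_law: "prob_space (path_law X P x)"
    and measurable_path_component: "(\<lambda>\<omega>. \<omega> n) \<in> path_law X P x \<rightarrow>\<^sub>M cemetery_space X"
proof -
  interpret IT: Ionescu_Tulcea "path_step X P x" "\<lambda>_. cemetery_space X"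
    by (rule Ionescu_Tulcea_path_step[OF assms])
  have L: "path_law X P x = IT.PF.lim"
    by (simp add: path_law_def)
  show sets: "sets (path_law X P x) = sets (Pi\<^sub>M UNIV (\<lambda>_. cemetery_space X))"
    by (simp add: L)
  then show "(\<lambda>\<omega>. \<omega> n) \<in> path_law X P x \<rightarrow>\<^sub>M cemetery_space X"
    by (simp cong: measurable_cong_sets)
  have "prob_space (distr (path_law X P x) (Pi\<^sub>M {} (\<lambda>_. cemetery_space X)) (\<lambda>\<omega>. restrict \<omega> {}))"
    unfolding L by (subst IT.distr_lim) (auto intro: IT.PF.prob_space_P)
  then show "prob_space (path_law X P x)"
    by (rule prob_space_distrD[rotated])
      (simp add: measurable_cong_sets[OF sets refl] measurable_restrict_subset)
qed

lemma nn_integral_path_law_restrict: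
  assumes P: "P \<in> X \<rightarrow>\<^sub>M subprob_algebra X" and x: "x \<in> space X"
    and g: "g \<in> borel_measurable (Pi\<^sub>M {0..<n} (\<lambda>_. cemetery_space X))"
  shows "(\<integral>\<^sup>+\<omega>. g (restrict \<omega> {0..<n}) \<partial>path_law X P x) =
    (\<integral>\<^sup>+\<omega>. g \<omega> \<partial>Ionescu_Tulcea.C (path_step X P x) (\<lambda>_. cemetery_space X) 0 n (\<lambda>_. undefined))"
proof -
  interpret IT: Ionescu_Tulcea "path_step X P x" "\<lambda>_. cemetery_space X"
    by (rule Ionescu_Tulcea_path_step[OF P x])
  let ?Q = "Pi\<^sub>M {0..<n} (\<lambda>_::nat. cemetery_space X)"
  let ?C = "IT.C 0 n (\<lambda>_. undefined)"
  have L: "path_law X P x = IT.PF.lim"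
    by (simp add: path_law_def)
  have r: "(\<lambda>\<omega>. restrict \<omega> {0..<n}) \<in> IT.PF.lim \<rightarrow>\<^sub>M ?Q"
    by (simp add: measurable_cong_sets[OF IT.PF.sets_lim refl] measurable_restrict_subset)
  have undef: "(\<lambda>_. undefined) \<in> space (Pi\<^sub>M {0..<0} (\<lambda>_::nat. cemetery_space X))"
    by (simp add: space_PiM)
  have up: "IT.up_to {0..<n} = n"
  proof (rule antisym)
    show "IT.up_to {0..<n} \<le> n"
      by (simp add: IT.up_to_iff)
    show "n \<le> IT.up_to {0..<n}"
      using IT.up_to[of "{0..<n}"] by auto
  qed
  have "IT.CI {0..<n} = ?C"
    unfolding IT.CI_def up using IT.distr_C[OF order_refl undef, of n] by simp
  then have "?C = distr IT.PF.lim ?Q (\<lambda>\<omega>. restrict \<omega> {0..<n})"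
    by (simp add: IT.distr_lim)
  then show ?thesis
    unfolding L using nn_integral_distr[OF r] g by simp
qed

text \<open>\<open>\<Phi>\<close> starts at \<open>x\<close> and is Markov: given the path \<open>\<Phi>\<^sub>0, \<dots>, \<Phi>\<^sub>n\<close>, the law of the next state is
  \<open>cemetery_kernel X P \<Phi>\<^sub>n\<close>.\<close>

lemma nn_integral_path_law_0:
  assumes P: "P \<in> X \<rightarrow>\<^sub>M subprob_algebra X" and x: "x \<in> space X"
    and f: "f \<in> borel_measurable (cemetery_space X)"
  shows "(\<integral>\<^sup>+\<omega>. f (\<omega> 0) \<partial>path_law X P x) = f (Some x)"
proof -
  interpret IT: Ionescu_Tulcea "path_step X P x" "\<lambda>_. cemetery_space X"
    by (rule Ionescu_Tulcea_path_step[OF P x])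
  have g: "(\<lambda>\<omega>. f (\<omega> 0)) \<in> borel_measurable (Pi\<^sub>M {0..<Suc 0} (\<lambda>_. cemetery_space X))"
    by (rule measurable_compose[OF _ f], rule measurable_component_singleton) simp
  have undef: "(\<lambda>_. undefined) \<in> space (Pi\<^sub>M {0..<0} (\<lambda>_::nat. cemetery_space X))"
    by (simp add: space_PiM)
  have "(\<integral>\<^sup>+\<omega>. f (\<omega> 0) \<partial>path_law X P x) = (\<integral>\<^sup>+\<omega>. f (\<omega> 0) \<partial>IT.C 0 (Suc 0) (\<lambda>_. undefined))"
    using nn_integral_path_law_restrict[OF P x g] by simp
  also have "IT.C 0 (Suc 0) (\<lambda>_. undefined) = IT.eP 0 (\<lambda>_. undefined)"
    using bind_return[OF IT.measurable_eP undef] by simp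
  also have "(\<integral>\<^sup>+\<omega>. f (\<omega> 0) \<partial>IT.eP 0 (\<lambda>_. undefined)) = (\<integral>\<^sup>+s. f s \<partial>path_step X P x 0 (\<lambda>_. undefined))"
    using IT.nn_integral_eP[OF undef g] by simp
  also have "\<dots> = f (Some x)"
    using x f by (simp add: path_step_def nn_integral_return space_cemetery_space)
  finally show ?thesis .
qed

lemma nn_integral_path_law_Suc:
  assumes P: "P \<in> X \<rightarrow>\<^sub>M subprob_algebra X" and x: "x \<in> space X"
    and h: "h \<in> borel_measurable (Pi\<^sub>M {0..<Suc (Suc n)} (\<lambda>_. cemetery_space X))"
  shows "(\<integral>\<^sup>+\<omega>. h (restrict \<omega> {0..<Suc (Suc n)}) \<partial>path_law X P x) =
    (\<integral>\<^sup>+\<omega>. (\<integral>\<^sup>+s. h (fun_upd (restrict \<omega> {0..<Suc n}) (Suc n) s) \<partial>cemetery_kernel X P (\<omega> n)) \<partial>path_law X P x)"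
proof -
  interpret IT: Ionescu_Tulcea "path_step X P x" "\<lambda>_. cemetery_space X"
    by (rule Ionescu_Tulcea_path_step[OF P x])
  let ?Q = "\<lambda>n. Pi\<^sub>M {0..<n} (\<lambda>_::nat. cemetery_space X)"
  let ?C = "IT.C 0 (Suc n) (\<lambda>_. undefined)"
  have undef: "(\<lambda>_. undefined) \<in> space (?Q 0)"
    by (simp add: space_PiM)
  have sets_C: "sets ?C = sets (?Q (Suc n))"
    using IT.sets_C[OF undef, of "Suc n"] by simp
  have eP: "IT.eP (Suc n) \<in> ?C \<rightarrow>\<^sub>M subprob_algebra (?Q (Suc (Suc n)))"
    unfolding measurable_cong_sets[OF sets_C refl] by (rule IT.measurable_eP)
  have g: "(\<lambda>\<omega>. \<integral>\<^sup>+\<omega>'. h \<omega>' \<partial>IT.eP (Suc n) \<omega>) \<in> borel_measurable (?Q (Suc n))"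
    by (rule measurable_compose[OF IT.measurable_eP nn_integral_measurable_subprob_algebra[OF h]])
  have step: "(\<integral>\<^sup>+\<omega>'. h \<omega>' \<partial>IT.eP (Suc n) \<omega>) =
      (\<integral>\<^sup>+s. h (fun_upd \<omega> (Suc n) s) \<partial>cemetery_kernel X P (\<omega> n))" if "\<omega> \<in> space (?Q (Suc n))" for \<omega>
    using IT.nn_integral_eP[OF that h] by (simp add: path_step_def)
  have "(\<integral>\<^sup>+\<omega>. h (restrict \<omega> {0..<Suc (Suc n)}) \<partial>path_law X P x) =
      (\<integral>\<^sup>+\<omega>. h \<omega> \<partial>(?C \<bind> IT.eP (Suc n)))"
    unfolding nn_integral_path_law_restrict[OF P x h] by simp
  also have "\<dots> = (\<integral>\<^sup>+\<omega>. (\<integral>\<^sup>+\<omega>'. h \<omega>' \<partial>IT.eP (Suc n) \<omega>) \<partial>?C)"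
    by (rule nn_integral_bind[OF h eP])
  also have "\<dots> = (\<integral>\<^sup>+\<omega>. (\<integral>\<^sup>+\<omega>'. h \<omega>' \<partial>IT.eP (Suc n) (restrict \<omega> {0..<Suc n})) \<partial>path_law X P x)"
    by (rule nn_integral_path_law_restrict[OF P x g, symmetric])
  also have "\<dots> = (\<integral>\<^sup>+\<omega>. (\<integral>\<^sup>+s. h (fun_upd (restrict \<omega> {0..<Suc n}) (Suc n) s) \<partial>cemetery_kernel X P (\<omega> n)) \<partial>path_law X P x)"
  proof (rule nn_integral_cong)
    fix \<omega> assume "\<omega> \<in> space (path_law X P x)"
    then have "restrict \<omega> {0..<Suc n} \<in> space (?Q (Suc n))"
      by (simp add: sets_eq_imp_space_eq[OF sets_path_law[OF P x]] space_PiM PiE_iff)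
    from step[OF this] show "(\<integral>\<^sup>+\<omega>'. h \<omega>' \<partial>IT.eP (Suc n) (restrict \<omega> {0..<Suc n})) =
        (\<integral>\<^sup>+s. h (fun_upd (restrict \<omega> {0..<Suc n}) (Suc n) s) \<partial>cemetery_kernel X P (\<omega> n))"
      by simp
  qed
  finally show ?thesis .
qed

lemma measurable_kernel_pow:
  assumes P: "P \<in> X \<rightarrow>\<^sub>M subprob_algebra X"
  shows "kernel_pow X P n \<in> X \<rightarrow>\<^sub>M subprob_algebra X"
proof (induction n)
  case 0
  then show ?case
    using return_measurable[of X] by (simp cong: measurable_cong)
next
  case (Suc n)
  then show ?case
    using measurable_bind2[OF Suc P] by (simp cong: measurable_cong)
qed

text \<open>\<open>\<P>\<^sub>x{\<Phi>\<^sub>n \<in> A} = P\<^sup>n(x, A)\<close>\<close>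

lemma nn_integral_path_component:
  assumes P: "P \<in> X \<rightarrow>\<^sub>M subprob_algebra X" and x: "x \<in> space X"
    and "f \<in> borel_measurable (cemetery_space X)" "f None = 0"
  shows "(\<integral>\<^sup>+\<omega>. f (\<omega> n) \<partial>path_law X P x) = (\<integral>\<^sup>+y. f (Some y) \<partial>kernel_pow X P n x)"
  using assms(3,4)
proof (induction n arbitrary: f)
  case 0
  then show ?case
    using x measurable_compose[OF measurable_Some_cemetery 0(1)]
    by (simp add: nn_integral_path_law_0[OF P] nn_integral_return)
next
  case (Suc n)
  let ?g = "\<lambda>s. \<integral>\<^sup>+t. f t \<partial>cemetery_kernel X P s"
  have g: "?g \<in> borel_measurable (cemetery_space X)"
    by (rule measurable_compose[OF measurable_cemetery_kernel[OF P]
          nn_integral_measurable_subprob_algebra[OF Suc.prems(1)]])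
  have h: "(\<lambda>\<omega>. f (\<omega> (Suc n))) \<in>
      borel_measurable (Pi\<^sub>M {0..<Suc (Suc n)} (\<lambda>_. cemetery_space X))"
    by (rule measurable_compose[OF _ Suc.prems(1)], rule measurable_component_singleton) simp
  have sets_pow: "sets (kernel_pow X P n x) = sets X"
    using measurable_kernel_pow[OF P] x by (rule subprob_measurableD)
  have "(\<integral>\<^sup>+\<omega>. f (\<omega> (Suc n)) \<partial>path_law X P x) = (\<integral>\<^sup>+\<omega>. ?g (\<omega> n) \<partial>path_law X P x)"
    using nn_integral_path_law_Suc[OF P x h] by simp
  also have "\<dots> = (\<integral>\<^sup>+y. ?g (Some y) \<partial>kernel_pow X P n x)"
    by (rule Suc.IH[OF g])
      (simp add: nn_integral_cemetery_kernel_None[OF Suc.prems(1)] Suc.prems(2))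
  also have "\<dots> = (\<integral>\<^sup>+y. (\<integral>\<^sup>+z. f (Some z) \<partial>P y) \<partial>kernel_pow X P n x)"
    by (rule nn_integral_cong)
      (simp add: nn_integral_cemetery_kernel_Some[OF P _ Suc.prems(1)] Suc.prems(2)
        sets_eq_imp_space_eq[OF sets_pow])
  also have "\<dots> = (\<integral>\<^sup>+z. f (Some z) \<partial>kernel_pow X P (Suc n) x)"
    using nn_integral_bind[OF measurable_compose[OF measurable_Some_cemetery Suc.prems(1)],
        of P "kernel_pow X P n x"] P
    by (simp add: measurable_cong_sets[OF sets_pow refl])
  finally show ?case .
qed

lemma emeasure_path_law_kernel_pow:
  assumes P: "P \<in> X \<rightarrow>\<^sub>M subprob_algebra X" and x: "x \<in> space X" and A: "A \<in> sets X"
  shows "emeasure (path_law X P x) {\<omega> \<in> space (path_law X P x). \<omega> n \<in> Some ` A} =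
    emeasure (kernel_pow X P n x) A"
proof -
  have sets_pow: "sets (kernel_pow X P n x) = sets X"
    using measurable_kernel_pow[OF P] x by (rule subprob_measurableD)
  have S: "Some ` A \<in> sets (cemetery_space X)"
    by (rule Some_image_in_sets_cemetery[OF A])
  have E: "{\<omega> \<in> space (path_law X P x). \<omega> n \<in> Some ` A} \<in> sets (path_law X P x)"
    using measurable_sets[OF measurable_path_component[OF P x, of n] S]
    by (simp add: vimage_def Int_def conj_commute)
  have "emeasure (path_law X P x) {\<omega> \<in> space (path_law X P x). \<omega> n \<in> Some ` A} =
      (\<integral>\<^sup>+\<omega>. indicator {\<omega> \<in> space (path_law X P x). \<omega> n \<in> Some ` A} \<omega> \<partial>path_law X P x)"
    using E by simp
  also have "\<dots> = (\<integral>\<^sup>+\<omega>. indicator (Some ` A) (\<omega> n) \<partial>path_law X P x)"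
    by (rule nn_integral_cong) (simp add: indicator_def)
  also have "\<dots> = (\<integral>\<^sup>+y. indicator (Some ` A) (Some y) \<partial>kernel_pow X P n x)"
    using S by (intro nn_integral_path_component[OF P x]) auto
  also have "\<dots> = (\<integral>\<^sup>+y. indicator A y \<partial>kernel_pow X P n x)"
    by (rule nn_integral_cong) (auto simp: indicator_def)
  also have "\<dots> = emeasure (kernel_pow X P n x) A"
    using A by (simp add: sets_pow)
  finally show ?thesis .
qed

lemma measurable_return_time:
  assumes P: "P \<in> X \<rightarrow>\<^sub>M subprob_algebra X" and x: "x \<in> space X" and A: "A \<in> sets X"
  shows "return_time A \<in> path_law X P x \<rightarrow>\<^sub>M count_space UNIV"
proof -
  let ?L = "path_law X P x"
  have [measurable]: "Measurable.pred ?L (\<lambda>\<omega>. \<omega> n \<in> Some ` A)" for n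
    using pred_sets2[OF Some_image_in_sets_cemetery[OF A] measurable_path_component[OF P x]] .
  have "return_time A \<omega> = (if \<exists>n\<ge>1. \<omega> n \<in> Some ` A
      then enat (LEAST n. 1 \<le> n \<and> \<omega> n \<in> Some ` A) else \<infinity>)" for \<omega>
  proof (cases "\<exists>n\<ge>1. \<omega> n \<in> Some ` A")
    case True
    let ?m = "LEAST n. 1 \<le> n \<and> \<omega> n \<in> Some ` A"
    from True obtain n where "1 \<le> n \<and> \<omega> n \<in> Some ` A" by blast
    from LeastI[of "\<lambda>n. 1 \<le> n \<and> \<omega> n \<in> Some ` A", OF this]
    have m: "enat ?m \<in> {enat n | n. 1 \<le> n \<and> \<omega> n \<in> Some ` A}"
      by blast
    have "enat ?m \<le> k" if "k \<in> {enat n | n. 1 \<le> n \<and> \<omega> n \<in> Some ` A}" for k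
    proof -
      from that obtain n where "k = enat n" "1 \<le> n \<and> \<omega> n \<in> Some ` A" by blast
      then show ?thesis
        using Least_le[of "\<lambda>n. 1 \<le> n \<and> \<omega> n \<in> Some ` A" n] by simp
    qed
    then have "Inf {enat n | n. 1 \<le> n \<and> \<omega> n \<in> Some ` A} = enat ?m"
      using m by (intro antisym Inf_greatest Inf_lower)
    with True show ?thesis by (simp add: return_time_def)
  next
    case False
    then have "{enat n | n. 1 \<le> n \<and> \<omega> n \<in> Some ` A} = {}" by blast
    then have "return_time A \<omega> = Inf {}" unfolding return_time_def by (rule arg_cong)
    with False show ?thesis by (simp only: Inf_empty top_enat_def if_False)
  qed
  then have eq: "return_time A = (\<lambda>\<omega>. if \<exists>n\<ge>1. \<omega> n \<in> Some ` A
      then enat (LEAST n. 1 \<le> n \<and> \<omega> n \<in> Some ` A) else \<infinity>)"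
    by (rule ext)
  show ?thesis
    unfolding eq by measurable
qed

end

theory Submission
  imports Defs
begin

text \<open>For \<open>\<kappa> > 1\<close> let \<open>U\<^sub>A = \<Sum>n\<ge>1. \<kappa>\<^sup>n P\<^sup>n 1\<^sub>A\<close> and \<open>F\<^sub>A = \<E>[\<kappa>^\<tau>\<^sub>A; \<tau>\<^sub>A < \<infinity>]\<close>. These are the least solutions of
  \<open>h = \<kappa> P(1\<^sub>A + h)\<close> and \<open>h = \<kappa> P(1\<^sub>A + 1\<^sub>X\<^sub>-\<^sub>A h)\<close>, so every estimate amounts to exhibiting a supersolution.
  If \<open>U\<^sub>A\<close> is finite on \<open>A\<close>, some slice \<open>B = {x \<in> A. m \<le> U\<^sub>A x \<le> m + 1/2}\<close> is not null, and \<open>U\<^sub>A / (1 + m)\<close> is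
  a supersolution for \<open>F\<^sub>B\<close>, whence \<open>F\<^sub>B \<le> (m + 1/2) / (1 + m) < 1\<close> on \<open>B\<close>. Conversely, if \<open>F\<^sub>A \<le> M < 1\<close> on \<open>A\<close>
  then \<open>F\<^sub>A / (1 - M)\<close> is a supersolution for \<open>U\<^sub>A\<close>. A bound on \<open>\<E>[\<kappa>^\<tau>\<^sub>A; \<tau>\<^sub>A < \<infinity>]\<close> and one below \<open>1\<close> on \<open>L\<close> combine
  by convexity after lowering \<open>\<kappa>\<close>. The drift function is \<open>1\<close> on \<open>A\<close> and \<open>F\<^sub>A\<close> off \<open>A\<close>; a given \<open>W\<close> makes
  \<open>\<kappa> P W\<close> a supersolution for \<open>F\<^sub>A\<close>. Finally \<open>h = U\<^sub>A\<close> satisfies \<open>\<kappa> P h \<le> h\<close>, is positive everywhere and, by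
  irreducibility, finite outside a null set, and each non-null \<open>{1/k \<le> h \<le> k}\<close> is uniformly transient at
  the rate \<open>(1 + \<kappa>) / 2\<close>, since the ratio of the rates makes a multiple of \<open>h\<close> a supersolution.\<close>

section \<open>Taboo iterates and their generating functions\<close>

definition kernel_apply :: "('a \<Rightarrow> 'a measure) \<Rightarrow> ('a \<Rightarrow> ennreal) \<Rightarrow> 'a \<Rightarrow> ennreal" where
  "kernel_apply P g x = (\<integral>\<^sup>+y. g y \<partial>P x)"

text \<open>Index \<open>n\<close> stands for \<open>n + 1\<close> steps. Only the \<open>n\<close>
  intermediate states are confined to \<open>C\<close>; the start and the end are free, so the
  target may lie outside \<open>C\<close>.\<close>

primrec taboo_iterate ::
  "('a \<Rightarrow> 'a measure) \<Rightarrow> 'a set \<Rightarrow> ('a \<Rightarrow> ennreal) \<Rightarrow> nat \<Rightarrow> 'a \<Rightarrow> ennreal" where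
  "taboo_iterate P C g 0 = kernel_apply P g"
| "taboo_iterate P C g (Suc n) = kernel_apply P (\<lambda>y. indicator C y * taboo_iterate P C g n y)"

text \<open>\<open>C = space X\<close> gives \<open>\<Sum>n\<ge>1. \<kappa>\<^sup>n P\<^sup>n(x, A)\<close>, and \<open>C = space X - A\<close> gives \<open>\<E>\<^sub>x[\<kappa>^\<tau>\<^sub>A; \<tau>\<^sub>A < \<infinity>]\<close>.\<close>

definition taboo_gf ::
  "('a \<Rightarrow> 'a measure) \<Rightarrow> ennreal \<Rightarrow> 'a set \<Rightarrow> 'a set \<Rightarrow> 'a \<Rightarrow> ennreal" where
  "taboo_gf P \<kappa> C A x = (\<Sum>n. \<kappa> ^ Suc n * taboo_iterate P C (indicator A) n x)"

text \<open>The definition peels off the first step, whereas \<open>kernel_pow\<close> and the path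
  law append a last one. This form lets inductions over either of them match.\<close>

lemma taboo_iterate_Suc_right:
  "taboo_iterate P C g (Suc n) = taboo_iterate P C (\<lambda>y. indicator C y * kernel_apply P g y) n"
  by (induction n) simp_all

lemma taboo_gf_mono:
  "\<kappa> \<le> \<kappa>' \<Longrightarrow> taboo_gf P \<kappa> C A x \<le> taboo_gf P \<kappa>' C A x"
  unfolding taboo_gf_def by (intro suminf_le summableI mult_right_mono power_mono) simp_all

text \<open>Powers are convex in the rate, and the bound is summed termwise. A rate slightly above 1
  thus costs little more than rate 1, which is what leads from (3) to (2).\<close>

lemma taboo_gf_convex:
  assumes "1 \<le> \<kappa>" "0 \<le> t" "t \<le> 1"
  shows "taboo_gf P (ennreal (1 - t + t * \<kappa>)) C A x \<le>
    ennreal (1 - t) * taboo_gf P 1 C A x + ennreal t * taboo_gf P (ennreal \<kappa>) C A x"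
proof -
  let ?a = "\<lambda>n. taboo_iterate P C (indicator A) n x"
  have power: "(1 - t + t * \<kappa>) ^ n \<le> 1 - t + t * \<kappa> ^ n" for n
  proof (induction n)
    case (Suc n)
    have "(1 - t + t * \<kappa>) ^ Suc n \<le> (1 - t + t * \<kappa>) * (1 - t + t * \<kappa> ^ n)"
      using Suc assms by (simp add: mult_left_mono)
    \<comment> \<open>The subtracted product is the convexity defect; it is nonnegative because
      \<kappa> and its powers are at least 1.\<close>
    also have "\<dots> = 1 - t + t * \<kappa> ^ Suc n - t * (1 - t) * ((\<kappa> - 1) * (\<kappa> ^ n - 1))"
      by (simp add: algebra_simps)
    also have "\<dots> \<le> 1 - t + t * \<kappa> ^ Suc n"
      using assms by (simp add: one_le_power)
    finally show ?case .
  qed simp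
  have "taboo_gf P (ennreal (1 - t + t * \<kappa>)) C A x \<le>
      (\<Sum>n. ennreal (1 - t) * (1 ^ Suc n * ?a n) + ennreal t * (ennreal \<kappa> ^ Suc n * ?a n))"
    unfolding taboo_gf_def
  proof (intro suminf_le summableI)
    fix n
    have "ennreal (1 - t + t * \<kappa>) ^ Suc n = ennreal ((1 - t + t * \<kappa>) ^ Suc n)"
      using assms by (intro ennreal_power) simp
    also have "\<dots> \<le> ennreal (1 - t + t * \<kappa> ^ Suc n)"
      by (rule ennreal_leI[OF power])
    also have "\<dots> = ennreal (1 - t) + ennreal t * ennreal \<kappa> ^ Suc n"
      using assms by (simp add: ennreal_plus ennreal_mult ennreal_power del: power_Suc)
    finally show "ennreal (1 - t + t * \<kappa>) ^ Suc n * ?a n \<le>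
        ennreal (1 - t) * (1 ^ Suc n * ?a n) + ennreal t * (ennreal \<kappa> ^ Suc n * ?a n)"
      by (rule order_trans[OF mult_right_mono]) (simp_all add: distrib_right mult.assoc)
  qed
  also have "\<dots> = ennreal (1 - t) * taboo_gf P 1 C A x + ennreal t * taboo_gf P (ennreal \<kappa>) C A x"
    unfolding taboo_gf_def by (simp add: suminf_add[symmetric] ennreal_suminf_cmult del: power_Suc)
  finally show ?thesis .
qed

section \<open>The first return time\<close>

text \<open>The infimum of a nonempty set in \<open>enat\<close> is attained, and that of the empty
  set is infinite. The event thus involves finitely many coordinates, within reach of the Markov
  property.\<close>

lemma return_time_eq_Suc_iff:
  "return_time A \<omega> = enat (Suc n) \<longleftrightarrow> \<omega> (Suc n) \<in> Some ` A \<and> (\<forall>i\<in>{1..n}. \<omega> i \<notin> Some ` A)"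
proof -
  let ?T = "{enat n | n. 1 \<le> n \<and> \<omega> n \<in> Some ` A}"
  show ?thesis
  proof
    assume eq: "return_time A \<omega> = enat (Suc n)"
    then have "?T \<noteq> {}"
      unfolding return_time_def by (metis Inf_empty enat.distinct(1) top_enat_def)
    then have "Inf ?T \<in> ?T"
      by (meson ex_in_conv wellorder_InfI)
    then have "\<omega> (Suc n) \<in> Some ` A"
      using eq by (auto simp: return_time_def)
    moreover have "\<omega> i \<notin> Some ` A" if "i \<in> {1..n}" for i
    proof
      assume "\<omega> i \<in> Some ` A"
      with that have "Inf ?T \<le> enat i" by (intro Inf_lower) auto
      with eq that show False by (simp add: return_time_def)
    qed
    ultimately show "\<omega> (Suc n) \<in> Some ` A \<and> (\<forall>i\<in>{1..n}. \<omega> i \<notin> Some ` A)" by blast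
  next
    assume *: "\<omega> (Suc n) \<in> Some ` A \<and> (\<forall>i\<in>{1..n}. \<omega> i \<notin> Some ` A)"
    show "return_time A \<omega> = enat (Suc n)"
      unfolding return_time_def
    proof (rule antisym)
      show "Inf ?T \<le> enat (Suc n)" using * by (intro Inf_lower) auto
      show "enat (Suc n) \<le> Inf ?T"
      proof (rule Inf_greatest)
        fix k assume "k \<in> ?T"
        then obtain m where "k = enat m" "1 \<le> m" "\<omega> m \<in> Some ` A" by blast
        with * show "enat (Suc n) \<le> k" by (cases "m \<le> n") auto
      qed
    qed
  qed
qed

lemma return_time_nonzero: "return_time A \<omega> \<noteq> 0"
proof -
  have "1 \<le> return_time A \<omega>"
    unfolding return_time_def by (rule Inf_greatest) (auto simp: one_enat_def)
  then show ?thesis by auto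
qed

section \<open>Calculus of the kernel operator\<close>

context
  fixes X :: "'a measure" and P :: "'a \<Rightarrow> 'a measure"
  assumes P [measurable]: "P \<in> X \<rightarrow>\<^sub>M subprob_algebra X"
begin

lemma sets_kernel: "x \<in> space X \<Longrightarrow> sets (P x) = sets X"
  using P by (rule subprob_measurableD)

lemma space_kernel: "x \<in> space X \<Longrightarrow> space (P x) = space X"
  by (rule sets_eq_imp_space_eq[OF sets_kernel])

lemma measurable_kernel_apply [measurable]:
  "g \<in> borel_measurable X \<Longrightarrow> kernel_apply P g \<in> borel_measurable X"
  unfolding kernel_apply_def[abs_def]
  by (rule measurable_compose[OF P nn_integral_measurable_subprob_algebra])

lemma kernel_apply_mono:
  "x \<in> space X \<Longrightarrow> (\<And>y. y \<in> space X \<Longrightarrow> f y \<le> g y) \<Longrightarrow> kernel_apply P f x \<le> kernel_apply P g x"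
  unfolding kernel_apply_def by (rule nn_integral_mono) (simp add: space_kernel)

lemma kernel_apply_cong:
  "x \<in> space X \<Longrightarrow> (\<And>y. y \<in> space X \<Longrightarrow> f y = g y) \<Longrightarrow> kernel_apply P f x = kernel_apply P g x"
  by (intro antisym kernel_apply_mono) simp_all

lemma borel_measurable_kernel:
  "x \<in> space X \<Longrightarrow> g \<in> borel_measurable X \<Longrightarrow> g \<in> borel_measurable (P x)"
  by (simp add: measurable_cong_sets[OF sets_kernel refl])

lemma kernel_apply_cmult:
  "x \<in> space X \<Longrightarrow> g \<in> borel_measurable X \<Longrightarrow> kernel_apply P (\<lambda>y. c * g y) x = c * kernel_apply P g x"
  unfolding kernel_apply_def by (rule nn_integral_cmult[OF borel_measurable_kernel])

lemma kernel_apply_add: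
  "x \<in> space X \<Longrightarrow> f \<in> borel_measurable X \<Longrightarrow> g \<in> borel_measurable X \<Longrightarrow>
    kernel_apply P (\<lambda>y. f y + g y) x = kernel_apply P f x + kernel_apply P g x"
  unfolding kernel_apply_def by (rule nn_integral_add[OF borel_measurable_kernel borel_measurable_kernel])

lemma kernel_apply_suminf:
  "x \<in> space X \<Longrightarrow> (\<And>n. f n \<in> borel_measurable X) \<Longrightarrow>
    kernel_apply P (\<lambda>y. \<Sum>n::nat. f n y) x = (\<Sum>n. kernel_apply P (f n) x)"
  unfolding kernel_apply_def by (rule nn_integral_suminf[OF borel_measurable_kernel])

lemma kernel_apply_sum:
  "x \<in> space X \<Longrightarrow> (\<And>n. f n \<in> borel_measurable X) \<Longrightarrow>
    kernel_apply P (\<lambda>y. \<Sum>n\<in>I. f n y) x = (\<Sum>n\<in>I. kernel_apply P (f n) x)"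
  unfolding kernel_apply_def by (rule nn_integral_sum[OF borel_measurable_kernel])

lemma measurable_taboo_iterate [measurable]:
  "C \<in> sets X \<Longrightarrow> g \<in> borel_measurable X \<Longrightarrow> taboo_iterate P C g n \<in> borel_measurable X"
proof (induction n)
  case (Suc n)
  then have [measurable]: "C \<in> sets X" "taboo_iterate P C g n \<in> borel_measurable X" by simp_all
  show ?case unfolding taboo_iterate.simps by measurable
qed simp

lemma taboo_iterate_cong:
  "x \<in> space X \<Longrightarrow> (\<And>y. y \<in> space X \<Longrightarrow> f y = g y) \<Longrightarrow>
    taboo_iterate P C f n x = taboo_iterate P C g n x"
  by (induction n arbitrary: x) (auto intro!: kernel_apply_cong)

lemma measurable_taboo_gf [measurable]:
  assumes [measurable]: "C \<in> sets X" "A \<in> sets X"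
  shows "taboo_gf P \<kappa> C A \<in> borel_measurable X"
  unfolding taboo_gf_def[abs_def] by measurable

section \<open>First-step equation and minimality\<close>

text \<open>Split off the first term of the series and pull one kernel step out of the rest. All
  terms are nonnegative, so the equation also holds where the series diverges.\<close>

lemma taboo_gf_eq:
  assumes [measurable]: "C \<in> sets X" "A \<in> sets X" and x: "x \<in> space X"
  shows "taboo_gf P \<kappa> C A x =
    \<kappa> * kernel_apply P (\<lambda>y. indicator A y + indicator C y * taboo_gf P \<kappa> C A y) x"
proof -
  let ?t = "taboo_iterate P C (indicator A)"
  have "(\<lambda>n. \<kappa> ^ Suc (Suc n) * ?t (Suc n) x) sums (\<Sum>n. \<kappa> ^ Suc (Suc n) * ?t (Suc n) x)"
    by (rule summable_sums[OF summableI])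
  from sums_Suc[OF this, THEN sums_unique]
  have "taboo_gf P \<kappa> C A x = \<kappa> * ?t 0 x + (\<Sum>n. \<kappa> ^ Suc (Suc n) * ?t (Suc n) x)"
    by (simp add: taboo_gf_def add.commute)
  also have "(\<Sum>n. \<kappa> ^ Suc (Suc n) * ?t (Suc n) x) =
      (\<Sum>n. \<kappa> * kernel_apply P (\<lambda>y. \<kappa> ^ Suc n * (indicator C y * ?t n y)) x)"
    by (subst kernel_apply_cmult[OF x]) (simp_all add: mult_ac)
  also have "\<dots> = \<kappa> * kernel_apply P (\<lambda>y. \<Sum>n. \<kappa> ^ Suc n * (indicator C y * ?t n y)) x"
    by (subst kernel_apply_suminf[OF x]) (simp_all add: ennreal_suminf_cmult)
  also have "(\<lambda>y. \<Sum>n. \<kappa> ^ Suc n * (indicator C y * ?t n y)) =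
      (\<lambda>y. indicator C y * taboo_gf P \<kappa> C A y)"
    unfolding taboo_gf_def ennreal_suminf_cmult[symmetric] by (simp add: mult_ac)
  finally show ?thesis
    by (subst kernel_apply_add[OF x]) (simp_all add: distrib_left)
qed

text \<open>The partial sums arise from 0 by iterating the monotone map on the left of
  \<open>super\<close>. By induction they stay below every supersolution, and so does their
  limit.\<close>

lemma taboo_gf_least:
  assumes [measurable]: "C \<in> sets X" "A \<in> sets X" and h: "h \<in> borel_measurable X"
    and super: "\<And>y. y \<in> space X \<Longrightarrow>
      \<kappa> * kernel_apply P (\<lambda>z. indicator A z + indicator C z * h z) y \<le> h y"
    and x: "x \<in> space X"
  shows "taboo_gf P \<kappa> C A x \<le> h x"
proof -
  let ?t = "taboo_iterate P C (indicator A)"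
  let ?S = "\<lambda>N y. \<Sum>n<N. \<kappa> ^ Suc n * ?t n y"
  have "?S N x \<le> h x" if "x \<in> space X" for N x
    using that
  proof (induction N arbitrary: x)
    case (Suc N)
    note x = Suc.prems
    have "?S (Suc N) x = \<kappa> * ?t 0 x + (\<Sum>n<N. \<kappa> ^ Suc (Suc n) * ?t (Suc n) x)"
      by (simp add: sum.lessThan_Suc_shift del: sum.lessThan_Suc)
    also have "(\<Sum>n<N. \<kappa> ^ Suc (Suc n) * ?t (Suc n) x) =
        (\<Sum>n<N. \<kappa> * kernel_apply P (\<lambda>y. \<kappa> ^ Suc n * (indicator C y * ?t n y)) x)"
      by (subst kernel_apply_cmult[OF x]) (simp_all add: mult_ac)
    also have "\<dots> = \<kappa> * kernel_apply P (\<lambda>y. \<Sum>n<N. \<kappa> ^ Suc n * (indicator C y * ?t n y)) x"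
      by (subst kernel_apply_sum[OF x]) (simp_all add: sum_distrib_left)
    also have "(\<lambda>y. \<Sum>n<N. \<kappa> ^ Suc n * (indicator C y * ?t n y)) = (\<lambda>y. indicator C y * ?S N y)"
      by (simp add: sum_distrib_left mult_ac)
    also have "\<kappa> * ?t 0 x + \<kappa> * kernel_apply P (\<lambda>y. indicator C y * ?S N y) x =
        \<kappa> * kernel_apply P (\<lambda>y. indicator A y + indicator C y * ?S N y) x"
      by (subst kernel_apply_add[OF x]) (simp_all add: distrib_left)
    also have "\<dots> \<le> \<kappa> * kernel_apply P (\<lambda>y. indicator A y + indicator C y * h y) x"
      using Suc.IH by (intro mult_left_mono kernel_apply_mono x add_left_mono) simp_all
    also have "\<dots> \<le> h x" by (rule super[OF x])
    finally show ?case .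
  qed simp
  then show ?thesis
    unfolding taboo_gf_def using x by (intro suminf_le_const summableI) simp
qed

section \<open>Identification with the n-step kernels and the path law\<close>

text \<open>The last step of \<open>kernel_pow\<close> is absorbed into the integrand as
  \<open>kernel_apply P g\<close>, so the induction needs \<open>g\<close> arbitrary.\<close>

lemma nn_integral_kernel_pow:
  assumes x: "x \<in> space X" and "g \<in> borel_measurable X"
  shows "(\<integral>\<^sup>+y. g y \<partial>kernel_pow X P (Suc n) x) = taboo_iterate P (space X) g n x"
  using assms(2)
proof (induction n arbitrary: g)
  case 0
  have "(\<integral>\<^sup>+y. g y \<partial>(return X x \<bind> P)) = (\<integral>\<^sup>+y. kernel_apply P g y \<partial>return X x)"
    unfolding kernel_apply_def by (rule nn_integral_bind[OF 0]) simp
  also have "\<dots> = kernel_apply P g x"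
    using 0 x by (simp add: nn_integral_return)
  finally show ?case by simp
next
  case (Suc n)
  have g[measurable]: "kernel_apply P g \<in> borel_measurable X"
    using Suc.prems by measurable
  have sets: "sets (kernel_pow X P (Suc n) x) = sets X"
    using measurable_kernel_pow[OF P] x by (rule subprob_measurableD)
  have "(\<integral>\<^sup>+y. g y \<partial>kernel_pow X P (Suc (Suc n)) x) =
      (\<integral>\<^sup>+y. kernel_apply P g y \<partial>kernel_pow X P (Suc n) x)"
    unfolding kernel_apply_def kernel_pow.simps(2)[of _ _ "Suc n"]
    by (rule nn_integral_bind[OF Suc.prems]) (simp only: measurable_cong_sets[OF sets refl] P)
  also have "\<dots> = taboo_iterate P (space X) (kernel_apply P g) n x"
    by (rule Suc.IH[OF g])
  also have "\<dots> = taboo_iterate P (space X) g (Suc n) x"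
    unfolding taboo_iterate_Suc_right by (rule taboo_iterate_cong[OF x]) simp
  finally show ?case .
qed

lemma emeasure_kernel_pow:
  assumes x: "x \<in> space X" and A: "A \<in> sets X"
  shows "emeasure (kernel_pow X P (Suc n) x) A = taboo_iterate P (space X) (indicator A) n x"
proof -
  have "sets (kernel_pow X P (Suc n) x) = sets X"
    using measurable_kernel_pow[OF P] x by (rule subprob_measurableD)
  then show ?thesis
    using nn_integral_kernel_pow[OF x, of "indicator A" n] A
    by (simp del: kernel_pow.simps)
qed

lemma suminf_kernel_pow:
  assumes "x \<in> space X" "A \<in> sets X" "0 \<le> \<kappa>"
  shows "(\<Sum>n. ennreal (\<kappa> ^ Suc n) * emeasure (kernel_pow X P (Suc n) x) A) =
    taboo_gf P (ennreal \<kappa>) (space X) A x"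
  using assms by (simp add: taboo_gf_def emeasure_kernel_pow ennreal_power del: kernel_pow.simps power_Suc)

text \<open>Integrating out the last coordinate replaces \<open>g\<close> by its mean under
  \<open>cemetery_kernel\<close>, which then absorbs the last factor of the product; hence the
  induction over arbitrary \<open>g\<close>. The product starts at time 1, since \<open>x\<close>
  itself may lie in \<open>A\<close>. The condition \<open>g None = 0\<close> discards the mass that
  has left \<open>X\<close>.\<close>

lemma nn_integral_taboo_path:
  assumes x: "x \<in> space X" and A: "A \<in> sets X"
    and "g \<in> borel_measurable (cemetery_space X)" "g None = 0"
  shows "(\<integral>\<^sup>+\<omega>. (\<Prod>i\<in>{1..n}. indicator (- Some ` A) (\<omega> i)) * g (\<omega> (Suc n)) \<partial>path_law X P x) =
    taboo_iterate P (space X - A) (\<lambda>y. g (Some y)) n x"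
proof -
  let ?I = "\<lambda>n \<omega>. \<Prod>i\<in>{1..n}. indicator (- Some ` A) (\<omega> i) :: ennreal"
  let ?K = "\<lambda>g s. \<integral>\<^sup>+t. g t \<partial>cemetery_kernel X P s"
  note [measurable] = Some_image_in_sets_cemetery[OF A]
  \<comment> \<open>The complement is taken in the whole type and need not be a measurable subset of
    the space, so its indicator is written as 1 minus a measurable one.\<close>
  have comp[measurable]: "indicator (- Some ` A) \<in> (borel_measurable (cemetery_space X) :: ('a option \<Rightarrow> ennreal) set)"
  proof -
    have "(\<lambda>s. 1 - indicator (Some ` A) s :: ennreal) \<in> borel_measurable (cemetery_space X)"
      by measurable
    also have "(\<lambda>s. 1 - indicator (Some ` A) s :: ennreal) = indicator (- Some ` A)"
      by (auto simp: indicator_def)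
    finally show ?thesis .
  qed
  have K: "?K g \<in> borel_measurable (cemetery_space X)" if "g \<in> borel_measurable (cemetery_space X)" for g
    by (rule measurable_compose[OF measurable_cemetery_kernel[OF P]
          nn_integral_measurable_subprob_algebra[OF that]])
  have step: "(\<integral>\<^sup>+\<omega>. ?I n \<omega> * g (\<omega> (Suc n)) \<partial>path_law X P x) =
      (\<integral>\<^sup>+\<omega>. ?I n \<omega> * ?K g (\<omega> n) \<partial>path_law X P x)"
    if g[measurable]: "g \<in> borel_measurable (cemetery_space X)" for n g
  proof -
    have h: "(\<lambda>\<omega>. ?I n \<omega> * g (\<omega> (Suc n))) \<in>
        borel_measurable (Pi\<^sub>M {0..<Suc (Suc n)} (\<lambda>_. cemetery_space X))"
    proof (intro borel_measurable_times_ennreal borel_measurable_prod_ennreal)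
      fix i assume "i \<in> {1..n}"
      then show "(\<lambda>\<omega>. indicator (- Some ` A) (\<omega> i) :: ennreal) \<in>
          borel_measurable (Pi\<^sub>M {0..<Suc (Suc n)} (\<lambda>_. cemetery_space X))"
        by (intro measurable_compose[OF _ comp] measurable_component_singleton) simp
    qed (intro measurable_compose[OF _ g] measurable_component_singleton, simp)
    have "(\<integral>\<^sup>+\<omega>. ?I n \<omega> * g (\<omega> (Suc n)) \<partial>path_law X P x) =
        (\<integral>\<^sup>+\<omega>. (\<integral>\<^sup>+s. ?I n \<omega> * g s \<partial>cemetery_kernel X P (\<omega> n)) \<partial>path_law X P x)"
      using nn_integral_path_law_Suc[OF P x h] by simp
    also have "\<dots> = (\<integral>\<^sup>+\<omega>. ?I n \<omega> * ?K g (\<omega> n) \<partial>path_law X P x)"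
      by (intro nn_integral_cong nn_integral_cmult)
        (simp add: measurable_cong_sets[OF sets_cemetery_kernel refl] g)
    finally show ?thesis .
  qed
  have K_Some: "?K g (Some y) = kernel_apply P (\<lambda>y. g (Some y)) y"
    if "y \<in> space X" "g \<in> borel_measurable (cemetery_space X)" "g None = 0" for g y
    using that by (simp add: nn_integral_cemetery_kernel_Some[OF P] kernel_apply_def)
  show ?thesis
    using assms(3,4)
  proof (induction n arbitrary: g)
    case 0
    have "(\<integral>\<^sup>+\<omega>. ?I 0 \<omega> * g (\<omega> (Suc 0)) \<partial>path_law X P x) = (\<integral>\<^sup>+\<omega>. ?K g (\<omega> 0) \<partial>path_law X P x)"
      unfolding step[OF 0(1)] by simp
    also have "\<dots> = ?K g (Some x)"
      by (rule nn_integral_path_law_0[OF P x K[OF 0(1)]])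
    finally show ?case
      using K_Some[OF x 0] by simp
  next
    case (Suc n)
    \<comment> \<open>The indicator is 1 at the cemetery. Still \<open>?g None = 0\<close>, because
      the cemetery is absorbing and \<open>g None = 0\<close>.\<close>
    let ?g = "\<lambda>s. indicator (- Some ` A) s * ?K g s"
    have g: "?g \<in> borel_measurable (cemetery_space X)"
      by (intro borel_measurable_times_ennreal comp K Suc.prems)
    have "(\<integral>\<^sup>+\<omega>. ?I (Suc n) \<omega> * g (\<omega> (Suc (Suc n))) \<partial>path_law X P x) =
        (\<integral>\<^sup>+\<omega>. ?I n \<omega> * ?g (\<omega> (Suc n)) \<partial>path_law X P x)"
      unfolding step[OF Suc.prems(1)] by (simp add: mult.assoc)
    also have "\<dots> = taboo_iterate P (space X - A) (\<lambda>y. ?g (Some y)) n x"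
      by (rule Suc.IH[OF g])
        (simp add: nn_integral_cemetery_kernel_None[OF Suc.prems(1)] Suc.prems(2))
    also have "\<dots> = taboo_iterate P (space X - A) (\<lambda>y. g (Some y)) (Suc n) x"
      unfolding taboo_iterate_Suc_right
      by (rule taboo_iterate_cong[OF x])
        (auto simp: K_Some[OF _ Suc.prems] indicator_def)
    finally show ?case .
  qed
qed

lemma return_moment_eq:
  assumes x: "x \<in> space X" and A: "A \<in> sets X" and \<kappa>: "0 \<le> \<kappa>"
  shows "return_moment X P \<kappa> x A = taboo_gf P (ennreal \<kappa>) (space X - A) A x"
proof -
  let ?L = "path_law X P x"
  let ?\<tau> = "return_time A"
  have [measurable]: "?\<tau> \<in> ?L \<rightarrow>\<^sub>M count_space UNIV"
    by (rule measurable_return_time[OF P x A])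
  \<comment> \<open>Decompose by the value of the return time. It is never 0, so
    \<open>Suc n\<close> covers all finite values; where it is infinite both sides vanish, whatever
    \<open>the_enat\<close> yields.\<close>
  have split: "ennreal (\<kappa> ^ the_enat (?\<tau> \<omega>)) * indicator {\<omega>. ?\<tau> \<omega> < \<infinity>} \<omega> =
      (\<Sum>n. ennreal \<kappa> ^ Suc n * (if ?\<tau> \<omega> = enat (Suc n) then 1 else 0))" for \<omega>
  proof (cases "?\<tau> \<omega>")
    case (enat m)
    then obtain k where m: "m = Suc k"
      using return_time_nonzero[of A \<omega>] by (cases m) (auto simp: zero_enat_def)
    have "(\<Sum>n. ennreal \<kappa> ^ Suc n * (if ?\<tau> \<omega> = enat (Suc n) then 1 else 0)) =
        (\<Sum>n\<in>{k}. ennreal \<kappa> ^ Suc n * (if ?\<tau> \<omega> = enat (Suc n) then 1 else 0))"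
      by (rule suminf_finite) (auto simp: enat m)
    then show ?thesis
      using \<kappa> by (simp add: enat m ennreal_power del: power_Suc)
  qed simp
  have "return_moment X P \<kappa> x A =
      (\<Sum>n. ennreal \<kappa> ^ Suc n * (\<integral>\<^sup>+\<omega>. (if ?\<tau> \<omega> = enat (Suc n) then 1 else 0) \<partial>?L))"
    unfolding return_moment_def split
    by (subst nn_integral_suminf, measurable) (simp add: nn_integral_cmult)
  moreover have "(\<integral>\<^sup>+\<omega>. (if ?\<tau> \<omega> = enat (Suc n) then 1 else 0) \<partial>?L) =
      taboo_iterate P (space X - A) (indicator A) n x" for n
  proof -
    have "(if ?\<tau> \<omega> = enat (Suc n) then 1 else 0 :: ennreal) =
        (\<Prod>i\<in>{1..n}. indicator (- Some ` A) (\<omega> i)) * indicator (Some ` A) (\<omega> (Suc n))" for \<omega>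
      by (auto simp: return_time_eq_Suc_iff indicator_def)
    then have "(\<integral>\<^sup>+\<omega>. (if ?\<tau> \<omega> = enat (Suc n) then 1 else 0) \<partial>?L) =
        taboo_iterate P (space X - A) (\<lambda>y. indicator (Some ` A) (Some y)) n x"
      using nn_integral_taboo_path[OF x A, of "indicator (Some ` A)" n]
        Some_image_in_sets_cemetery[OF A] by simp
    also have "\<dots> = taboo_iterate P (space X - A) (indicator A) n x"
      by (rule taboo_iterate_cong[OF x]) (auto simp: indicator_def)
    finally show ?thesis .
  qed
  ultimately show ?thesis by (simp add: taboo_gf_def)
qed

text \<open>Powers of 1 are 1. This places the return probability in the same family of generating
  functions, at rate 1.\<close>

lemma return_prob_eq:
  assumes x: "x \<in> space X" and A: "A \<in> sets X"
  shows "return_prob X P x A = return_moment X P 1 x A"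
proof -
  have [measurable]: "return_time A \<in> path_law X P x \<rightarrow>\<^sub>M count_space UNIV"
    by (rule measurable_return_time[OF P x A])
  have "return_prob X P x A =
      (\<integral>\<^sup>+\<omega>. indicator {\<omega> \<in> space (path_law X P x). return_time A \<omega> < \<infinity>} \<omega> \<partial>path_law X P x)"
    unfolding return_prob_def by (rule nn_integral_indicator[symmetric]) measurable
  also have "\<dots> = return_moment X P 1 x A"
    unfolding return_moment_def by (rule nn_integral_cong) (simp add: indicator_def)
  finally show ?thesis .
qed

section \<open>Comparisons through supersolutions\<close>

text \<open>The supersolution is \<open>?c * ?h\<close>. On \<open>B\<close> the source term 1
  equals \<open>?c * (1 + m)\<close> and is paid by \<open>?c * (1 + ?h)\<close>, as
  \<open>B\<close> lies in \<open>A\<close>; off \<open>B\<close> the comparison is immediate. The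
  first-step equation for \<open>?h\<close> closes the estimate.\<close>

lemma taboo_gf_slice_le:
  assumes A[measurable]: "A \<in> sets X" and x: "x \<in> space X" and m: "0 \<le> m"
    and B[measurable]: "B \<in> sets X" and "B \<subseteq> A"
    and low: "\<And>y. y \<in> B \<Longrightarrow> ennreal m \<le> taboo_gf P \<kappa> (space X) A y"
  shows "taboo_gf P \<kappa> (space X - B) B x \<le> ennreal (1 / (1 + m)) * taboo_gf P \<kappa> (space X) A x"
proof (rule taboo_gf_least[OF _ B _ _ x])
  let ?h = "taboo_gf P \<kappa> (space X) A" and ?c = "ennreal (1 / (1 + m))"
  show "(\<lambda>x. ?c * ?h x) \<in> borel_measurable X" by measurable
  fix y assume y: "y \<in> space X"
  have "kernel_apply P (\<lambda>z. indicator B z + indicator (space X - B) z * (?c * ?h z)) y \<le>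
      kernel_apply P (\<lambda>z. ?c * (indicator A z + indicator (space X) z * ?h z)) y"
  proof (rule kernel_apply_mono[OF y])
    fix z assume z: "z \<in> space X"
    show "indicator B z + indicator (space X - B) z * (?c * ?h z) \<le>
        ?c * (indicator A z + indicator (space X) z * ?h z)"
    proof (cases "z \<in> B")
      case True
      have "(1::ennreal) = ?c * ennreal (1 + m)"
        using m by (simp add: ennreal_mult[symmetric] del: ennreal_plus)
      also have "\<dots> \<le> ?c * (1 + ?h z)"
        using low[OF True] m by (intro mult_left_mono) (simp_all add: ennreal_plus)
      finally show ?thesis
        using True z \<open>B \<subseteq> A\<close> by (auto simp: indicator_def)
    next
      case False
      then show ?thesis using z by (auto simp: distrib_left)
    qed
  qed
  also have "\<dots> = ?c * kernel_apply P (\<lambda>z. indicator A z + indicator (space X) z * ?h z) y"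
    by (rule kernel_apply_cmult[OF y]) measurable
  finally have "\<kappa> * kernel_apply P (\<lambda>z. indicator B z + indicator (space X - B) z * (?c * ?h z)) y \<le>
      ?c * (\<kappa> * kernel_apply P (\<lambda>z. indicator A z + indicator (space X) z * ?h z) y)"
    unfolding mult.left_commute[of ?c] by (rule mult_left_mono) simp
  then show "\<kappa> * kernel_apply P (\<lambda>z. indicator B z + indicator (space X - B) z * (?c * ?h z)) y \<le> ?c * ?h y"
    unfolding taboo_gf_eq[OF sets.top A y, symmetric] .
qed measurable

lemma taboo_gf_space_le:
  assumes A[measurable]: "A \<in> sets X" and x: "x \<in> space X"
    and M: "0 \<le> M" "M < 1"
    and bound: "\<And>y. y \<in> A \<Longrightarrow> taboo_gf P \<kappa> (space X - A) A y \<le> ennreal M"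
  shows "taboo_gf P \<kappa> (space X) A x \<le> ennreal (1 / (1 - M)) * taboo_gf P \<kappa> (space X - A) A x"
proof -
  \<comment> \<open>On \<open>A\<close> the source 1 and the term \<open>d * M\<close> must together
    fit into \<open>d\<close>; this is the solution of \<open>1 + d * M = d\<close>. Off
    \<open>A\<close> both sides agree.\<close>
  define d where "d = 1 / (1 - M)"
  have d: "0 \<le> d" "1 + d * M = d"
    using M by (simp_all add: d_def field_simps)
  show ?thesis unfolding d_def[symmetric]
  proof (rule taboo_gf_least[OF _ A _ _ x])
    let ?F = "taboo_gf P \<kappa> (space X - A) A" and ?c = "ennreal d"
    show "(\<lambda>x. ?c * ?F x) \<in> borel_measurable X" by measurable
    fix y assume y: "y \<in> space X"
    have "kernel_apply P (\<lambda>z. indicator A z + indicator (space X) z * (?c * ?F z)) y \<le>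
        kernel_apply P (\<lambda>z. ?c * (indicator A z + indicator (space X - A) z * ?F z)) y"
    proof (rule kernel_apply_mono[OF y])
      fix z assume z: "z \<in> space X"
      show "indicator A z + indicator (space X) z * (?c * ?F z) \<le>
          ?c * (indicator A z + indicator (space X - A) z * ?F z)"
      proof (cases "z \<in> A")
        case True
        have "1 + ?c * ?F z \<le> 1 + ?c * ennreal M"
          by (intro add_left_mono mult_left_mono bound True) simp
        also have "\<dots> = ennreal (1 + d * M)"
          using d M by (subst ennreal_plus) (simp_all add: ennreal_mult)
        also have "\<dots> = ennreal d" by (simp only: d)
        finally show ?thesis using True z by simp
      qed (use z in simp)
    qed
    also have "\<dots> = ?c * kernel_apply P (\<lambda>z. indicator A z + indicator (space X - A) z * ?F z) y"
      by (rule kernel_apply_cmult[OF y]) measurable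
    finally have "\<kappa> * kernel_apply P (\<lambda>z. indicator A z + indicator (space X) z * (?c * ?F z)) y \<le>
        ?c * (\<kappa> * kernel_apply P (\<lambda>z. indicator A z + indicator (space X - A) z * ?F z) y)"
      unfolding mult.left_commute[of ?c] by (rule mult_left_mono) simp
    then show "\<kappa> * kernel_apply P (\<lambda>z. indicator A z + indicator (space X) z * (?c * ?F z)) y \<le> ?c * ?F y"
      using taboo_gf_eq[OF sets.Diff[OF sets.top A] A y, of \<kappa>] by simp
  qed measurable
qed

text \<open>The source \<open>indicator B\<close> is dominated by \<open>k * h\<close>, so a
  multiple of \<open>h\<close> pays for it once the rate is lowered.\<close>

lemma taboo_gf_space_le_of_superharmonic:
  assumes B[measurable]: "B \<in> sets X" and h[measurable]: "h \<in> borel_measurable X"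
    and \<kappa>: "0 < \<kappa>'" "\<kappa>' < \<kappa>" and k: "0 \<le> k"
    and super: "\<And>y. y \<in> space X \<Longrightarrow> ennreal \<kappa> * kernel_apply P h y \<le> h y"
    and low: "\<And>y. y \<in> B \<Longrightarrow> 1 \<le> ennreal k * h y"
    and x: "x \<in> space X"
  shows "taboo_gf P (ennreal \<kappa>') (space X) B x \<le> ennreal (k * \<kappa>' / (\<kappa> - \<kappa>')) * h x"
proof -
  \<comment> \<open>The solution of \<open>\<kappa>' * (k + c) = \<kappa> * c\<close>; it is
    nonnegative because of the gap between the two rates.\<close>
  define c where "c = k * \<kappa>' / (\<kappa> - \<kappa>')"
  have c: "0 \<le> c" "\<kappa>' * (k + c) = \<kappa> * c"
    using \<kappa> k by (simp_all add: c_def field_simps)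
  show ?thesis unfolding c_def[symmetric]
  proof (rule taboo_gf_least[OF _ B _ _ x])
    show "(\<lambda>x. ennreal c * h x) \<in> borel_measurable X" by measurable
    fix y assume y: "y \<in> space X"
    have "kernel_apply P (\<lambda>z. indicator B z + indicator (space X) z * (ennreal c * h z)) y \<le>
        kernel_apply P (\<lambda>z. ennreal (k + c) * h z) y"
    proof (rule kernel_apply_mono[OF y])
      fix z assume z: "z \<in> space X"
      have "indicator B z \<le> ennreal k * h z"
        using low by (auto simp: indicator_def)
      then show "indicator B z + indicator (space X) z * (ennreal c * h z) \<le> ennreal (k + c) * h z"
        using z k c(1) by (simp add: ennreal_plus distrib_right add_right_mono)
    qed
    also have "\<dots> = ennreal (k + c) * kernel_apply P h y"
      by (rule kernel_apply_cmult[OF y h])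
    finally have "ennreal \<kappa>' * kernel_apply P (\<lambda>z. indicator B z + indicator (space X) z * (ennreal c * h z)) y \<le>
        ennreal \<kappa>' * (ennreal (k + c) * kernel_apply P h y)"
      by (rule mult_left_mono) simp
    also have "\<dots> = ennreal (\<kappa>' * (k + c)) * kernel_apply P h y"
      using \<kappa> k c(1) by (simp add: ennreal_mult mult.assoc del: ennreal_plus)
    also have "\<dots> = ennreal c * (ennreal \<kappa> * kernel_apply P h y)"
      using \<kappa> c(1) unfolding c(2) by (simp add: ennreal_mult mult_ac)
    also have "\<dots> \<le> ennreal c * h y"
      by (intro mult_left_mono super y) simp
    finally show "ennreal \<kappa>' * kernel_apply P (\<lambda>z. indicator B z + indicator (space X) z * (ennreal c * h z)) y \<le>
      ennreal c * h y" .
  qed measurable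
qed

text \<open>As \<kappa> exceeds 1, every iterate of the kernel keeps \<open>h\<close> below itself.
  From a point where \<open>h\<close> is finite, no power of the kernel charges the infinity set,
  and irreducibility makes that set null.\<close>

lemma superharmonic_infinite_null:
  assumes irr: "irreducibility_measure X P \<psi>"
    and h[measurable]: "h \<in> borel_measurable X" and \<kappa>: "1 < \<kappa>"
    and super: "\<And>y. y \<in> space X \<Longrightarrow> ennreal \<kappa> * kernel_apply P h y \<le> h y"
    and x: "x \<in> space X" "h x < \<infinity>"
  shows "emeasure \<psi> {y \<in> space X. h y = \<infinity>} = 0"
proof (rule ccontr)
  let ?N = "{y \<in> space X. h y = \<infinity>}"
  have N: "?N \<in> sets X" by measurable
  have P_le: "kernel_apply P h y \<le> h y" if "y \<in> space X" for y
  proof -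
    have "1 * kernel_apply P h y \<le> ennreal \<kappa> * kernel_apply P h y"
      using \<kappa> by (intro mult_right_mono) simp_all
    with super[OF that] show ?thesis by simp
  qed
  have iter: "taboo_iterate P (space X) h n y \<le> h y" if "y \<in> space X" for n y
    using that
  proof (induction n arbitrary: y)
    case (Suc n)
    have "taboo_iterate P (space X) h (Suc n) y \<le> kernel_apply P h y"
      unfolding taboo_iterate.simps by (rule kernel_apply_mono[OF Suc.prems]) (simp add: Suc.IH)
    with P_le[OF Suc.prems] show ?case by simp
  qed (simp add: P_le)
  assume "emeasure \<psi> ?N \<noteq> 0"
  then have "0 < emeasure \<psi> ?N" by (rule zero_less_iff_neq_zero[THEN iffD2])
  with irr N x(1) have "\<exists>n\<ge>1. emeasure (kernel_pow X P n x) ?N > 0"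
    unfolding irreducibility_measure_def by blast
  then obtain n where "n \<ge> 1" and pos: "emeasure (kernel_pow X P n x) ?N > 0" by blast
  then obtain m where n: "n = Suc m" by (cases n) auto
  have sets: "sets (kernel_pow X P n x) = sets X"
    using measurable_kernel_pow[OF P] x(1) by (rule subprob_measurableD)
  have "(\<integral>\<^sup>+y. h y \<partial>kernel_pow X P n x) < \<infinity>"
    unfolding n nn_integral_kernel_pow[OF x(1) h] using iter[OF x(1), of m] x(2) by (rule le_less_trans)
  then have "emeasure (kernel_pow X P n x) (h -` {\<infinity>} \<inter> space (kernel_pow X P n x)) = 0"
    by (intro nn_integral_PInf) (simp_all add: measurable_cong_sets[OF sets refl])
  moreover have "h -` {\<infinity>} \<inter> space (kernel_pow X P n x) = ?N"
    by (auto simp: sets_eq_imp_space_eq[OF sets])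
  ultimately show False using pos by simp
qed

section \<open>Slicing and geometric transience\<close>

text \<open>Countably many slices of width 1/2 cover \<open>A\<close>, so one of them is not null.
  Width below 1 is what makes the ratio \<open>(m + 1 / 2) / (1 + m)\<close> less than 1 at every
  height \<open>m\<close>.\<close>

lemma exists_slice_taboo_gf_lt_1:
  assumes sets_\<psi>: "sets \<psi> = sets X" and A: "A \<in> pos_sets X \<psi>"
    and fin: "\<And>x. x \<in> A \<Longrightarrow> taboo_gf P \<kappa> (space X) A x < \<infinity>"
  shows "\<exists>B\<in>pos_sets X \<psi>. (SUP x\<in>B. taboo_gf P \<kappa> (space X - B) B x) < 1"
proof -
  let ?h = "taboo_gf P \<kappa> (space X) A"
  define B where "B k = {x \<in> A. ennreal (real k / 2) \<le> ?h x \<and> ?h x \<le> ennreal (real k / 2 + 1 / 2)}" for k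
  have A_sets[measurable]: "A \<in> sets X" using A by (simp add: pos_sets_def)
  have sub: "B k \<subseteq> A" for k by (auto simp: B_def)
  have B_eq: "B k = {x \<in> space X. x \<in> A \<and> ennreal (real k / 2) \<le> ?h x \<and> ?h x \<le> ennreal (real k / 2 + 1 / 2)}" for k
    using sets.sets_into_space[OF A_sets] by (auto simp: B_def)
  have B_sets: "B k \<in> sets X" for k
    unfolding B_eq by measurable
  have "A \<subseteq> (\<Union>k. B k)"
  proof
    fix x assume x: "x \<in> A"
    obtain r where r: "?h x = ennreal r" "0 \<le> r"
      using fin[OF x] by (cases "?h x") auto
    \<comment> \<open>This index gives \<open>?k / 2 \<le> r \<le> ?k / 2 + 1 / 2\<close>.\<close>
    let ?k = "nat \<lfloor>2 * r\<rfloor>"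
    have "real ?k \<le> 2 * r" "2 * r \<le> real ?k + 1"
      using r(2) by linarith+
    then have "x \<in> B ?k"
      using x r by (auto simp: B_def field_simps simp del: ennreal_plus intro!: ennreal_leI)
    then show "x \<in> (\<Union>k. B k)" by blast
  qed
  then have "A = (\<Union>k. B k)" using sub by blast
  moreover have "emeasure \<psi> A \<noteq> 0" using A by (simp add: pos_sets_def)
  ultimately obtain k where "emeasure \<psi> (B k) \<noteq> 0"
    using emeasure_UN_eq_0[of \<psi> B] B_sets sets_\<psi> by auto
  then have pos: "B k \<in> pos_sets X \<psi>"
    using B_sets[of k] by (simp add: pos_sets_def zero_less_iff_neq_zero)
  define m where "m = real k / 2"
  have m: "0 \<le> m" by (simp add: m_def)
  have "taboo_gf P \<kappa> (space X - B k) (B k) x \<le> ennreal ((m + 1 / 2) / (1 + m))" if x: "x \<in> B k" for x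
  proof -
    have "x \<in> space X" using x sets.sets_into_space[OF B_sets] by blast
    then have "taboo_gf P \<kappa> (space X - B k) (B k) x \<le> ennreal (1 / (1 + m)) * ?h x"
      by (intro taboo_gf_slice_le[OF A_sets _ m B_sets sub]) (auto simp: B_def m_def)
    also have "\<dots> \<le> ennreal (1 / (1 + m)) * ennreal (m + 1 / 2)"
      using x by (intro mult_left_mono) (auto simp: B_def m_def simp del: ennreal_plus)
    also have "\<dots> = ennreal ((m + 1 / 2) / (1 + m))"
      using m by (simp add: ennreal_mult[symmetric] del: ennreal_plus)
    finally show ?thesis .
  qed
  then have "(SUP x\<in>B k. taboo_gf P \<kappa> (space X - B k) (B k) x) \<le> ennreal ((m + 1 / 2) / (1 + m))"
    by (rule SUP_least)
  also have "\<dots> < 1"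
    using m by (simp add: ennreal_less_one_iff)
  finally show ?thesis using pos by blast
qed

text \<open>The infinity set of \<open>h\<close> serves as the null set \<open>D\<close>, and the
  sets on which \<open>h\<close> lies between \<open>1 / k\<close> and \<open>k\<close> exhaust the
  rest. The lower bound on \<open>h\<close> makes it dominate the indicator; the upper bound makes
  the resulting estimate uniform.\<close>

lemma geometrically_transient_of_superharmonic:
  assumes irr: "psi_irreducible X P \<psi>"
    and h[measurable]: "h \<in> borel_measurable X" and \<kappa>: "1 < \<kappa>"
    and super: "\<And>y. y \<in> space X \<Longrightarrow> ennreal \<kappa> * kernel_apply P h y \<le> h y"
    and pos: "\<And>y. y \<in> space X \<Longrightarrow> 0 < h y"
    and x: "x \<in> space X" "h x < \<infinity>"
  shows "geometrically_transient X P \<psi>"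
proof -
  let ?N = "{y \<in> space X. h y = \<infinity>}"
  define B where "B n = {y \<in> space X. ennreal (1 / Suc n) \<le> h y \<and> h y \<le> ennreal (Suc n)}" for n
  have irr': "irreducibility_measure X P \<psi>" and \<psi>: "emeasure \<psi> (space X) \<noteq> 0"
    using irr by (auto simp: psi_irreducible_def)
  then have sets_\<psi>: "sets \<psi> = sets X"
    by (simp add: irreducibility_measure_def)
  have N: "?N \<in> sets X" "emeasure \<psi> ?N = 0"
    using superharmonic_infinite_null[OF irr' h \<kappa> super x] by simp_all
  have B_sets[measurable]: "B n \<in> sets X" for n
    unfolding B_def by measurable
  \<comment> \<open>Every member of the final family must be non-null. By monotonicity one non-null
    \<open>B K\<close> makes all later ones non-null, and dropping the earlier ones keeps the
    union.\<close>
  have B_mono: "B m \<subseteq> B n" if "m \<le> n" for m n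
  proof -
    have "ennreal (1 / Suc n) \<le> ennreal (1 / Suc m)" "ennreal (Suc m) \<le> ennreal (Suc n)"
      using that by (auto intro!: ennreal_leI simp: field_simps)
    then show ?thesis unfolding B_def by (blast intro: order_trans)
  qed
  have cover: "space X = ?N \<union> (\<Union>n. B n)"
  proof (intro equalityI subsetI)
    fix y assume y: "y \<in> space X"
    show "y \<in> ?N \<union> (\<Union>n. B n)"
    proof (cases "h y")
      case (real r)
      then have "0 < r" using pos[OF y] by simp
      obtain m where m: "inverse (real (Suc m)) < r" using reals_Archimedean[OF \<open>0 < r\<close>] by blast
      obtain n where n: "r \<le> real n" using real_arch_simple by blast
      have "1 / Suc (max m n) \<le> 1 / Suc m" by (simp add: field_simps)
      with m n have "1 / Suc (max m n) \<le> r" "r \<le> Suc (max m n)" by (simp_all add: inverse_eq_divide)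
      then have "y \<in> B (max m n)"
        using y real by (auto simp: B_def simp del: ennreal_plus of_nat_Suc intro!: ennreal_leI)
      then show ?thesis by blast
    qed (use y in simp)
  qed (auto simp: B_def)
  have "\<exists>K. emeasure \<psi> (B K) \<noteq> 0"
  proof (rule ccontr)
    assume "\<nexists>K. emeasure \<psi> (B K) \<noteq> 0"
    then have "emeasure \<psi> (\<Union>n. B n) = 0"
      using B_sets by (intro emeasure_UN_eq_0) (auto simp: sets_\<psi>)
    then have "?N \<union> (\<Union>n. B n) \<in> null_sets \<psi>"
      using N by (intro null_sets.Un) (auto simp: sets_\<psi>)
    then have "emeasure \<psi> (space X) = 0"
      unfolding cover[symmetric] by (rule null_setsD1)
    with \<psi> show False by simp
  qed
  then obtain K where K: "emeasure \<psi> (B K) \<noteq> 0" ..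
  have "uniformly_geometric_transient X P \<psi> (B (K + i))" for i
  proof -
    \<comment> \<open>The midpoint \<open>?\<kappa>'\<close> lies strictly between 1 and \<kappa>:
      it is still a geometric rate, yet leaves the gap needed for the comparison.\<close>
    let ?B = "B (K + i)" and ?k = "real (Suc (K + i))" and ?\<kappa>' = "(1 + \<kappa>) / 2"
    have "emeasure \<psi> (B K) \<le> emeasure \<psi> ?B"
      by (intro emeasure_mono B_mono) (simp_all add: sets_\<psi>)
    then have "?B \<in> pos_sets X \<psi>"
      using K by (auto simp: pos_sets_def zero_less_iff_neq_zero)
    moreover have "1 < ?\<kappa>'" using \<kappa> by simp
    moreover have "(SUP x\<in>?B. \<Sum>n. ennreal (?\<kappa>' ^ Suc n) * emeasure (kernel_pow X P (Suc n) x) ?B) < \<infinity>"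
    proof -
      define c where "c = ?k * ?\<kappa>' / (\<kappa> - ?\<kappa>')"
      have "(\<Sum>n. ennreal (?\<kappa>' ^ Suc n) * emeasure (kernel_pow X P (Suc n) y) ?B) \<le> ennreal c * ennreal ?k"
        if y: "y \<in> ?B" for y
      proof -
        have y': "y \<in> space X" using y by (simp add: B_def)
        have "(\<Sum>n. ennreal (?\<kappa>' ^ Suc n) * emeasure (kernel_pow X P (Suc n) y) ?B) =
            taboo_gf P (ennreal ?\<kappa>') (space X) ?B y"
          using \<kappa> by (intro suminf_kernel_pow y' B_sets) simp
        also have "\<dots> \<le> ennreal c * h y"
          unfolding c_def
        proof (rule taboo_gf_space_le_of_superharmonic[OF B_sets h _ _ _ super _ y'])
          fix z assume "z \<in> ?B"
          then have "ennreal ?k * ennreal (1 / ?k) \<le> ennreal ?k * h z"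
            by (intro mult_left_mono) (simp_all add: B_def)
          moreover have "ennreal ?k * ennreal (1 / ?k) = 1"
            by (subst ennreal_mult[symmetric]) simp_all
          ultimately show "1 \<le> ennreal ?k * h z" by simp
        qed (use \<kappa> in simp_all)
        also have "\<dots> \<le> ennreal c * ennreal ?k"
          using y by (intro mult_left_mono) (simp_all add: B_def)
        finally show ?thesis .
      qed
      then have "(SUP x\<in>?B. \<Sum>n. ennreal (?\<kappa>' ^ Suc n) * emeasure (kernel_pow X P (Suc n) x) ?B) \<le>
          ennreal c * ennreal ?k"
        by (rule SUP_least)
      also have "\<dots> < \<infinity>" by (simp add: ennreal_mult_less_top)
      finally show ?thesis .
    qed
    ultimately show ?thesis
      unfolding uniformly_geometric_transient_def by blast
  qed
  moreover have "space X = ?N \<union> (\<Union>i\<in>{1..}. B (K + i))"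
  proof -
    \<comment> \<open>The family is indexed from 1, so \<open>Suc n\<close> is used as the
      index.\<close>
    have "B n \<subseteq> (\<Union>i\<in>{1..}. B (K + i))" for n
      using B_mono[of n "K + Suc n"] by (intro subset_trans[OF _ UN_upper[of "Suc n"]]) simp_all
    then have "(\<Union>i\<in>{1..}. B (K + i)) = (\<Union>n. B n)" by blast
    then show ?thesis using cover by (rule ssubst)
  qed
  ultimately show ?thesis
    unfolding geometrically_transient_def using irr N
    by (intro conjI exI[of _ ?N] exI[of _ "\<lambda>i. B (K + i)"]) simp_all
qed

section \<open>Drift functions\<close>

text \<open>The first-step equation reads \<open>?F = \<kappa> P W\<close>, so
  \<open>P W = ?F / \<kappa>\<close> everywhere. Off \<open>A\<close> this is
  \<open>W / \<kappa>\<close>, and on \<open>A\<close> it is at most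
  \<open>1 / \<kappa>\<close>.\<close>

lemma taboo_gf_drift:
  assumes A[measurable]: "A \<in> sets X" and x: "x \<in> space X" and \<kappa>: "1 < \<kappa>"
  defines "W \<equiv> \<lambda>x. indicator A x + indicator (space X - A) x * taboo_gf P (ennreal \<kappa>) (space X - A) A x"
  assumes bound: "\<And>y. y \<in> A \<Longrightarrow> taboo_gf P (ennreal \<kappa>) (space X - A) A y \<le> 1"
  shows "(\<integral>\<^sup>+y. W y \<partial>P x) \<le>
    ennreal (1 / \<kappa>) * W x * indicator (space X - A) x + ennreal (1 / \<kappa>) * indicator A x"
proof -
  let ?F = "taboo_gf P (ennreal \<kappa>) (space X - A) A"
  have "ennreal (1 / \<kappa>) * ?F x = ennreal (1 / \<kappa>) * (ennreal \<kappa> * kernel_apply P W x)"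
    unfolding W_def by (subst taboo_gf_eq[OF _ A x]) simp_all
  also have "\<dots> = kernel_apply P W x"
    using \<kappa> by (simp add: mult.assoc[symmetric] ennreal_mult[symmetric])
  finally have PW: "(\<integral>\<^sup>+y. W y \<partial>P x) = ennreal (1 / \<kappa>) * ?F x"
    by (simp add: kernel_apply_def)
  show ?thesis
  proof (cases "x \<in> A")
    case True
    then show ?thesis
      unfolding PW using mult_left_mono[OF bound[OF True], of "ennreal (1 / \<kappa>)"] by simp
  next
    case False
    then show ?thesis
      unfolding PW using x by (simp add: W_def)
  qed
qed

text \<open>It suffices that \<open>1_A + 1_C * \<kappa> P W \<le> W\<close>, with \<open>C\<close>
  the complement of \<open>A\<close>: on \<open>A\<close> because \<open>W\<close> is at least 1, on
  \<open>C\<close> by drift and \<open>\<kappa> * l \<le> 1\<close>. The bound by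
  \<open>\<kappa> P W\<close> is sharper on \<open>A\<close> than one by \<open>W\<close>, since
  there the drift in (4) bounds \<open>P W\<close> by \<open>b\<close>.\<close>

lemma taboo_gf_le_drift:
  assumes A[measurable]: "A \<in> sets X" and W[measurable]: "W \<in> borel_measurable X"
    and ge: "\<And>y. y \<in> A \<Longrightarrow> 1 \<le> W y"
    and drift: "\<And>y. y \<in> space X - A \<Longrightarrow> kernel_apply P W y \<le> ennreal l * W y"
    and l: "0 < l" "0 < \<kappa>" "\<kappa> * l \<le> 1" and x: "x \<in> space X"
  shows "taboo_gf P (ennreal \<kappa>) (space X - A) A x \<le> ennreal \<kappa> * kernel_apply P W x"
proof (rule taboo_gf_least[OF _ A _ _ x])
  show "(\<lambda>x. ennreal \<kappa> * kernel_apply P W x) \<in> borel_measurable X" by measurable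
  fix y assume y: "y \<in> space X"
  show "ennreal \<kappa> * kernel_apply P (\<lambda>z. indicator A z + indicator (space X - A) z *
      (ennreal \<kappa> * kernel_apply P W z)) y \<le> ennreal \<kappa> * kernel_apply P W y"
  proof (intro mult_left_mono kernel_apply_mono y)
    fix z assume z: "z \<in> space X"
    show "indicator A z + indicator (space X - A) z * (ennreal \<kappa> * kernel_apply P W z) \<le> W z"
    proof (cases "z \<in> A")
      case False
      have "ennreal \<kappa> * kernel_apply P W z \<le> ennreal \<kappa> * (ennreal l * W z)"
        using False z by (intro mult_left_mono drift) simp_all
      also have "\<dots> = ennreal (\<kappa> * l) * W z"
        using l by (simp add: ennreal_mult mult.assoc)
      also have "\<dots> \<le> 1 * W z"
        using l by (intro mult_right_mono) simp_all
      finally show ?thesis using False z by simp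
    qed (simp add: ge)
  qed simp
qed measurable

end

section \<open>The equivalence of the five conditions\<close>

theorem theorem2p2:
  fixes X :: "'a measure" and P :: "'a \<Rightarrow> 'a measure" and \<psi> :: "'a measure"
  assumes "countably_generated X"
    and "P \<in> X \<rightarrow>\<^sub>M subprob_algebra X"
    and "psi_irreducible X P \<psi>"
  shows "let
      s1 = (\<exists>A\<in>pos_sets X \<psi>. \<exists>\<kappa>::real. \<kappa> > 1 \<and>
              (SUP x\<in>A. \<Sum>n. ennreal (\<kappa> ^ Suc n) * emeasure (kernel_pow X P (Suc n) x) A) < \<infinity>);
      s2 = (\<exists>A\<in>pos_sets X \<psi>. \<exists>\<kappa>::real. \<kappa> > 1 \<and>
              (SUP x\<in>A. return_moment X P \<kappa> x A) < 1);
      s3 = (\<exists>A\<in>pos_sets X \<psi>. \<exists>\<kappa>::real. \<kappa> > 1 \<and>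
              (SUP x\<in>A. return_prob X P x A) < 1 \<and>
              (SUP x\<in>A. return_moment X P \<kappa> x A) < \<infinity>);
      s4 = (\<exists>A\<in>pos_sets X \<psi>. \<exists>b\<in>{0<..<1::real}. \<exists>l\<in>{0<..<1::real}.
              \<exists>W :: 'a \<Rightarrow> ennreal. W \<in> borel_measurable X \<and>
                (\<forall>x\<in>space X. indicator A x \<le> W x) \<and>
                (\<exists>x\<^sub>0\<in>space X. W x\<^sub>0 < \<infinity>) \<and>
                (\<forall>x\<in>space X. (\<integral>\<^sup>+y. W y \<partial>P x) \<le>
                   ennreal l * W x * indicator (space X - A) x + ennreal b * indicator A x));
      s5 = geometrically_transient X P \<psi>
    in (s1 \<longleftrightarrow> s2) \<and> (s2 \<longleftrightarrow> s3) \<and> (s3 \<longleftrightarrow> s4) \<and> (s4 \<longleftrightarrow> s5)"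
proof -
  note P = assms(2) and psi = assms(3)
  have irr: "irreducibility_measure X P \<psi>"
    using psi by (simp add: psi_irreducible_def)
  then have sets_\<psi>: "sets \<psi> = sets X"
    by (simp add: irreducibility_measure_def)
  have pos_sets: "A \<in> sets X" "A \<subseteq> space X" "A \<noteq> {}" if "A \<in> pos_sets X \<psi>" for A
    using that sets.sets_into_space[of A X] by (auto simp: pos_sets_def)
  let ?U = "\<lambda>\<kappa> A x. taboo_gf P (ennreal \<kappa>) (space X) A x"
  let ?F = "\<lambda>\<kappa> A x. taboo_gf P (ennreal \<kappa>) (space X - A) A x"
  have U: "(SUP x\<in>A. \<Sum>n. ennreal (\<kappa> ^ Suc n) * emeasure (kernel_pow X P (Suc n) x) A) = (SUP x\<in>A. ?U \<kappa> A x)"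
    if "A \<in> pos_sets X \<psi>" "\<kappa> > 1" for A \<kappa>
    using that pos_sets[OF that(1)] by (intro SUP_cong refl suminf_kernel_pow[OF P]) auto
  have F: "(SUP x\<in>A. return_moment X P \<kappa> x A) = (SUP x\<in>A. ?F \<kappa> A x)"
    if "A \<in> pos_sets X \<psi>" "\<kappa> > 1" for A \<kappa>
    using that pos_sets[OF that(1)] by (intro SUP_cong refl return_moment_eq[OF P]) auto
  have L: "(SUP x\<in>A. return_prob X P x A) = (SUP x\<in>A. ?F 1 A x)"
    if "A \<in> pos_sets X \<psi>" for A
    using pos_sets[OF that]
    by (intro SUP_cong refl) (auto simp: return_prob_eq[OF P] return_moment_eq[OF P])
  \<comment> \<open>Real bounds are extracted so that the constants below can be computed with
    subtraction and division in the reals.\<close>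
  have SUP_real: "\<exists>M\<ge>0. (SUP x\<in>A. f x) = ennreal M \<and> (\<forall>x\<in>A. f x \<le> ennreal M)"
    if "(SUP x\<in>A. f x) < \<infinity>" for A :: "'a set" and f :: "'a \<Rightarrow> ennreal"
  proof (cases "SUP x\<in>A. f x")
    case (real M)
    then show ?thesis by (metis SUP_upper)
  qed (use that in \<open>simp only: infinity_ennreal_def less_irrefl\<close>)

  define s1 where "s1 \<longleftrightarrow> (\<exists>A\<in>pos_sets X \<psi>. \<exists>\<kappa>::real. \<kappa> > 1 \<and> (SUP x\<in>A. ?U \<kappa> A x) < \<infinity>)"
  define s2 where "s2 \<longleftrightarrow> (\<exists>A\<in>pos_sets X \<psi>. \<exists>\<kappa>::real. \<kappa> > 1 \<and> (SUP x\<in>A. ?F \<kappa> A x) < 1)"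
  define s3 where "s3 \<longleftrightarrow> (\<exists>A\<in>pos_sets X \<psi>. \<exists>\<kappa>::real. \<kappa> > 1 \<and>
    (SUP x\<in>A. ?F 1 A x) < 1 \<and> (SUP x\<in>A. ?F \<kappa> A x) < \<infinity>)"
  define s4 where "s4 \<longleftrightarrow> (\<exists>A\<in>pos_sets X \<psi>. \<exists>b\<in>{0<..<1::real}. \<exists>l\<in>{0<..<1::real}.
    \<exists>W :: 'a \<Rightarrow> ennreal. W \<in> borel_measurable X \<and>
      (\<forall>x\<in>space X. indicator A x \<le> W x) \<and>
      (\<exists>x\<^sub>0\<in>space X. W x\<^sub>0 < \<infinity>) \<and>
      (\<forall>x\<in>space X. (\<integral>\<^sup>+y. W y \<partial>P x) \<le>
         ennreal l * W x * indicator (space X - A) x + ennreal b * indicator A x))"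
  \<comment> \<open>Conditions (1), (3) and (4) are each shown equivalent to (2), and (5) to
    (1).\<close>
  have "s2" if *: "s1"
  proof -
    obtain A and \<kappa> :: real where A: "A \<in> pos_sets X \<psi>" "\<kappa> > 1" and fin: "(SUP x\<in>A. ?U \<kappa> A x) < \<infinity>"
      using * unfolding s1_def by blast
    have "?U \<kappa> A x < \<infinity>" if "x \<in> A" for x
      using SUP_upper[OF that, of "?U \<kappa> A"] fin by (rule le_less_trans)
    from exists_slice_taboo_gf_lt_1[OF P sets_\<psi> A(1) this] show ?thesis
      unfolding s2_def using A(2) by blast
  qed
  moreover have "s1" if *: "s2"
  proof -
    obtain A and \<kappa> :: real where A: "A \<in> pos_sets X \<psi>" "\<kappa> > 1" and lt: "(SUP x\<in>A. ?F \<kappa> A x) < 1"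
      using * unfolding s2_def by blast
    then obtain M where M: "0 \<le> M" "(SUP x\<in>A. ?F \<kappa> A x) = ennreal M" "\<And>x. x \<in> A \<Longrightarrow> ?F \<kappa> A x \<le> ennreal M"
      using SUP_real[where A = A and f = "?F \<kappa> A"] less_trans[OF lt, of \<infinity>] by auto
    have "M < 1" using lt M by simp
    have "?U \<kappa> A x \<le> ennreal (1 / (1 - M)) * ennreal M" if "x \<in> A" for x
      using taboo_gf_space_le[OF P pos_sets(1)[OF A(1)] _ M(1) \<open>M < 1\<close> M(3)] that pos_sets[OF A(1)]
      by (intro order_trans[OF _ mult_left_mono[OF M(3)[OF that]]]) auto
    then have "(SUP x\<in>A. ?U \<kappa> A x) \<le> ennreal (1 / (1 - M)) * ennreal M"
      by (rule SUP_least)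
    also have "\<dots> < \<infinity>" by (simp add: ennreal_mult_less_top)
    finally show ?thesis unfolding s1_def using A by blast
  qed
  moreover have "s3" if *: "s2"
  proof -
    obtain A and \<kappa> :: real where A: "A \<in> pos_sets X \<psi>" "\<kappa> > 1" and lt: "(SUP x\<in>A. ?F \<kappa> A x) < 1"
      using * unfolding s2_def by blast
    have "(SUP x\<in>A. ?F 1 A x) \<le> (SUP x\<in>A. ?F \<kappa> A x)"
      using A(2) by (intro SUP_mono' taboo_gf_mono ennreal_leI) simp
    then have "(SUP x\<in>A. ?F 1 A x) < 1" using lt by (rule le_less_trans)
    moreover have "(SUP x\<in>A. ?F \<kappa> A x) < \<infinity>" using lt by (rule less_trans) simp
    ultimately show ?thesis unfolding s3_def using A by blast
  qed
  moreover have "s2" if *: "s3"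
  proof -
    obtain A and \<kappa> :: real where A: "A \<in> pos_sets X \<psi>" "\<kappa> > 1"
      and lt: "(SUP x\<in>A. ?F 1 A x) < 1" and fin: "(SUP x\<in>A. ?F \<kappa> A x) < \<infinity>"
      using * unfolding s3_def by blast
    obtain M where M: "0 \<le> M" "\<And>x. x \<in> A \<Longrightarrow> ?F \<kappa> A x \<le> ennreal M"
      using SUP_real[OF fin] by blast
    obtain l where l: "0 \<le> l" "(SUP x\<in>A. ?F 1 A x) = ennreal l" "\<And>x. x \<in> A \<Longrightarrow> ?F 1 A x \<le> ennreal l"
      using SUP_real[where A = A and f = "?F 1 A"] less_trans[OF lt, of \<infinity>] by auto
    have "l < 1" using lt l by simp
    \<comment> \<open>Chosen so that \<open>l + t * M = (1 + l) / 2 - t\<close>, which is below 1.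
      The summand in \<open>M + 1\<close> keeps the denominator positive and
      \<open>t \<le> 1\<close>.\<close>
    define t where "t = (1 - l) / (2 * (M + 1))"
    have t: "0 < t" "t \<le> 1" and tM: "t * (M + 1) = (1 - l) / 2"
      using M(1) l(1) \<open>l < 1\<close> by (simp_all add: t_def divide_simps)
    let ?\<kappa>' = "1 - t + t * \<kappa>"
    have "?F ?\<kappa>' A x \<le> ennreal (l + t * M)" if "x \<in> A" for x
    proof -
      have "?F ?\<kappa>' A x \<le> ennreal (1 - t) * ?F 1 A x + ennreal t * ?F \<kappa> A x"
        using taboo_gf_convex[of \<kappa> t] A(2) t by simp
      also have "\<dots> \<le> ennreal 1 * ennreal l + ennreal t * ennreal M"
        using t M(2)[OF that] l(3)[OF that] by (intro add_mono mult_mono ennreal_leI) simp_all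
      also have "\<dots> = ennreal (l + t * M)"
        using l(1) t M(1) by (simp add: ennreal_mult)
      finally show ?thesis .
    qed
    then have "(SUP x\<in>A. ?F ?\<kappa>' A x) \<le> ennreal (l + t * M)"
      by (rule SUP_least)
    also have "l + t * M < 1"
      using tM t \<open>l < 1\<close> by (simp add: distrib_left)
    then have "ennreal (l + t * M) < 1"
      using l(1) t M(1) by (simp add: ennreal_less_one_iff del: ennreal_plus)
    finally have "(SUP x\<in>A. ?F ?\<kappa>' A x) < 1" .
    moreover have "?\<kappa>' > 1"
      using mult_strict_left_mono[OF A(2) t(1)] by simp
    ultimately show ?thesis unfolding s2_def using A(1) by blast
  qed
  moreover have "s4" if *: "s2"
  proof -
    obtain A and \<kappa> :: real where A: "A \<in> pos_sets X \<psi>" "\<kappa> > 1" and lt: "(SUP x\<in>A. ?F \<kappa> A x) < 1"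
      using * unfolding s2_def by blast
    note [measurable] = pos_sets(1)[OF A(1)] measurable_taboo_gf[OF P]
    let ?W = "\<lambda>x. indicator A x + indicator (space X - A) x * ?F \<kappa> A x"
    have "?F \<kappa> A x \<le> 1" if "x \<in> A" for x
      using SUP_upper[OF that, of "?F \<kappa> A"] lt by (rule order_trans[OF _ less_imp_le])
    note drift = taboo_gf_drift[OF P pos_sets(1)[OF A(1)] _ A(2) this]
    \<comment> \<open>Any point of the non-null, hence nonempty, set \<open>A\<close> serves as the
      finiteness point: \<open>?W\<close> is 1 there.\<close>
    obtain a where "a \<in> A" using pos_sets[OF A(1)] by blast
    then have "\<exists>x\<in>space X. ?W x < \<infinity>"
      using pos_sets[OF A(1)] by (intro bexI[of _ a]) auto
    moreover have "?W \<in> borel_measurable X" by measurable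
    moreover have "1 / \<kappa> \<in> {0<..<1}" using A(2) by simp
    ultimately show ?thesis
      unfolding s4_def using drift
      by (intro bexI[OF _ A(1)] bexI[of _ "1 / \<kappa>"] exI[of _ ?W]) simp_all
  qed
  moreover have "s2" if *: "s4"
  proof -
    obtain A b l W where A: "A \<in> pos_sets X \<psi>" and b: "0 < b" "b < 1" and l: "0 < l" "l < 1"
      and W[measurable]: "W \<in> borel_measurable X" and ge: "\<And>x. x \<in> space X \<Longrightarrow> indicator A x \<le> W x"
      and drift: "\<And>x. x \<in> space X \<Longrightarrow> kernel_apply P W x \<le>
         ennreal l * W x * indicator (space X - A) x + ennreal b * indicator A x"
      using * unfolding s4_def kernel_apply_def by auto
    \<comment> \<open>Both entries exceed 1. The first yields \<open>\<kappa> * l \<le> 1\<close>;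
      the second yields the strict bound \<open>\<kappa> * b < 1\<close>, which \<open>1 / b\<close>
      would miss.\<close>
    define \<kappa> where "\<kappa> = min (1 / l) (2 / (1 + b))"
    have "\<kappa> > 1" using b l by (simp add: \<kappa>_def)
    have "\<kappa> * l \<le> (1 / l) * l" using l by (intro mult_right_mono) (simp_all add: \<kappa>_def)
    then have \<kappa>l: "\<kappa> * l \<le> 1" using l by simp
    have "\<kappa> * b \<le> (2 / (1 + b)) * b" using b by (intro mult_right_mono) (simp_all add: \<kappa>_def)
    also have "\<dots> < 1" using b by (simp add: field_simps)
    finally have \<kappa>b: "\<kappa> * b < 1" .
    have "?F \<kappa> A x \<le> ennreal (\<kappa> * b)" if "x \<in> A" for x
    proof -
      have x: "x \<in> space X" using that pos_sets[OF A] by blast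
      have "?F \<kappa> A x \<le> ennreal \<kappa> * kernel_apply P W x"
      proof (rule taboo_gf_le_drift[OF P pos_sets(1)[OF A] W _ _ l(1) _ \<kappa>l x])
        show "1 \<le> W y" if "y \<in> A" for y
          using ge[of y] that pos_sets[OF A] by auto
        show "kernel_apply P W y \<le> ennreal l * W y" if "y \<in> space X - A" for y
          using drift[of y] that by simp
      qed (use \<open>\<kappa> > 1\<close> in simp)
      also have "\<dots> \<le> ennreal \<kappa> * ennreal b"
        using drift[OF x] that by (intro mult_left_mono) simp_all
      also have "\<dots> = ennreal (\<kappa> * b)"
        using b \<open>\<kappa> > 1\<close> by (simp add: ennreal_mult)
      finally show ?thesis .
    qed
    then have "(SUP x\<in>A. ?F \<kappa> A x) \<le> ennreal (\<kappa> * b)"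
      by (rule SUP_least)
    also have "\<dots> < 1" using \<kappa>b b \<open>\<kappa> > 1\<close> by (simp add: ennreal_less_one_iff)
    finally show ?thesis unfolding s2_def using A \<open>\<kappa> > 1\<close> by blast
  qed
  moreover have "geometrically_transient X P \<psi>" if *: "s1"
  proof -
    obtain A and \<kappa> :: real where A: "A \<in> pos_sets X \<psi>" "\<kappa> > 1" and fin: "(SUP x\<in>A. ?U \<kappa> A x) < \<infinity>"
      using * unfolding s1_def by blast
    note A_sets[measurable] = pos_sets(1)[OF A(1)]
    obtain a where a: "a \<in> A" "a \<in> space X" using pos_sets[OF A(1)] by blast
    show ?thesis
    \<comment> \<open>Dropping the source \<open>indicator A\<close> from the first-step equation
      shows that \<open>?U \<kappa> A\<close> is superharmonic at rate \<kappa>.\<close>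
    proof (rule geometrically_transient_of_superharmonic[OF P psi _ A(2) _ _ a(2)])
      show "?U \<kappa> A \<in> borel_measurable X"
        by (rule measurable_taboo_gf[OF P sets.top A_sets])
      show "?U \<kappa> A a < \<infinity>"
        using SUP_upper[OF a(1), of "?U \<kappa> A"] fin by (rule le_less_trans)
      fix y assume y: "y \<in> space X"
      have "ennreal \<kappa> * kernel_apply P (?U \<kappa> A) y \<le>
          ennreal \<kappa> * kernel_apply P (\<lambda>z. indicator A z + indicator (space X) z * ?U \<kappa> A z) y"
        by (intro mult_left_mono kernel_apply_mono[OF P y]) simp_all
      then show "ennreal \<kappa> * kernel_apply P (?U \<kappa> A) y \<le> ?U \<kappa> A y"
        unfolding taboo_gf_eq[OF P sets.top A_sets y, symmetric] .
      \<comment> \<open>Irreducibility makes one term of the series positive at \<open>y\<close>,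
        hence the whole sum.\<close>
      obtain n where "n \<ge> 1" "emeasure (kernel_pow X P n y) A > 0"
        using irr A y unfolding irreducibility_measure_def pos_sets_def by blast
      moreover from \<open>n \<ge> 1\<close> obtain m where "n = Suc m" by (cases n) auto
      ultimately have "0 < taboo_iterate P (space X) (indicator A) m y"
        by (simp add: emeasure_kernel_pow[OF P y A_sets] del: kernel_pow.simps)
      then have "0 < ennreal \<kappa> ^ Suc m * taboo_iterate P (space X) (indicator A) m y"
        using A(2) by (simp add: ennreal_zero_less_mult_iff ennreal_power del: power_Suc)
      also have "\<dots> \<le> ?U \<kappa> A y"
        unfolding taboo_gf_def
        using sum_le_suminf[OF summableI, of "{m}" "\<lambda>n. ennreal \<kappa> ^ Suc n * taboo_iterate P (space X) (indicator A) n y"]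
        by simp
      finally show "0 < ?U \<kappa> A y" .
    qed
  qed
  moreover have "s1" if *: "geometrically_transient X P \<psi>"
  proof -
    obtain A where "uniformly_geometric_transient X P \<psi> A"
      using * unfolding geometrically_transient_def by blast
    then obtain \<kappa> where A: "A \<in> pos_sets X \<psi>" "\<kappa> > 1" and fin:
      "(SUP x\<in>A. \<Sum>n. ennreal (\<kappa> ^ Suc n) * emeasure (kernel_pow X P (Suc n) x) A) < \<infinity>"
      unfolding uniformly_geometric_transient_def by blast
    show ?thesis
      using A fin unfolding s1_def U[OF A] by blast
  qed
  ultimately have "(s1 \<longleftrightarrow> s2) \<and> (s2 \<longleftrightarrow> s3) \<and> (s3 \<longleftrightarrow> s4) \<and> (s4 \<longleftrightarrow> geometrically_transient X P \<psi>)"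
    by blast
  then show ?thesis
    \<comment> \<open>The rewrites \<open>U\<close>, \<open>F\<close> and \<open>L\<close> are
      conditional; the congruence rules supply membership in \<open>pos_sets\<close> and
      \<open>\<kappa> > 1\<close> under the quantifiers.\<close>
    unfolding s1_def s2_def s3_def s4_def by (simp only: Let_def U F L cong: conj_cong bex_cong)
qed

end
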